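(* Let $J:\mathbb{R}^n\to\mathbb{C}$ satisfy $\int_{\mathbb{R}^n}|J(x)|\,dx=1$ and $J\in L^1(\mathbb{R}^n)\cap L^{1+\varepsilon_0}(\mathbb{R}^n)$ for some $0<\varepsilon_0\leq\infty$. Then for any $u_0\in L^1(\mathbb{R}^n)$, the solution $u(t)$ of $$\partial_tu(x,t)=\int_{\mathbb{R}^n}J(x-y)u(y,t)\,dy-u(x,t),\quad (x,t)\in\mathbb{R}^n\times(0,\infty),$$ with initial value $u_0$ satisfies $$\left\|u(t)-e^{-t}\sum_{k=0}^{N-1}\frac{t^k}{k!}\mathcal{J}^ku_0\right\|_{L^\infty}\lesssim t^{-n/2}\quad\text{as } t\to\infty,$$ where $N=\lceil\frac{1}{\varepsilon_0}\rceil+1$.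
   Context: $\mathcal{J}u=J\ast u$ and $\mathcal{J}^k$ is its $k$-fold composition ($\mathcal{J}^0$ the identity). By definition, the solution of $\partial_tu=\mathcal{J}u-\chi_0u$ with initial value $u_0$ is $u(t)=e^{-\chi_0t}\sum_{k=0}^\infty\frac{t^k}{k!}\mathcal{J}^ku_0$; here $\chi_0=1$. When $\varepsilon_0=\infty$, $1/\varepsilon_0=0$ and $L^{1+\varepsilon_0}=L^\infty$. The notation $f(t)\lesssim g(t)$ as $t\to\infty$ means that there are constants $C,t_0>0$ with $f(t)\le Cg(t)$ for all $t\ge t_0$. *)

theory Defs
  imports "HOL-Analysis.Analysis" "HOL-Probability.Essential_Supremum"
begin

definition in_Lp :: "ennreal \<Rightarrow> ('a::euclidean_space \<Rightarrow> complex) \<Rightarrow> bool" where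
  "in_Lp p f \<longleftrightarrow> f \<in> borel_measurable lebesgue \<and>
     (if p = \<infinity> then esssup lebesgue (\<lambda>x. ennreal (norm (f x))) < \<infinity>
      else integrable lebesgue (\<lambda>x. norm (f x) powr enn2real p))"

definition Linf_norm :: "('a::euclidean_space \<Rightarrow> complex) \<Rightarrow> ennreal" where
  "Linf_norm f = esssup lebesgue (\<lambda>x. ennreal (norm (f x)))"

text \<open>For integrable \<open>J\<close> and \<open>u\<close> the integral exists for almost every \<open>x\<close>; elsewhere its value is 0.\<close>

definition conv_op :: "('a::euclidean_space \<Rightarrow> complex) \<Rightarrow> ('a \<Rightarrow> complex) \<Rightarrow> 'a \<Rightarrow> complex" where
  "conv_op J u = (\<lambda>x. LINT y|lebesgue. J (x - y) * u y)"

definition exp_partial_sum ::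
  "('a::euclidean_space \<Rightarrow> complex) \<Rightarrow> real \<Rightarrow> ('a \<Rightarrow> complex) \<Rightarrow> nat \<Rightarrow> real \<Rightarrow> 'a \<Rightarrow> complex" where
  "exp_partial_sum J \<chi>0 u0 m t x =
     of_real (exp (- \<chi>0 * t)) * (\<Sum>k<m. of_real (t ^ k / fact k) * (conv_op J ^^ k) u0 x)"

text \<open>
  The solution of \<open>\<partial>\<^sub>t u = J * u - \<chi>0 u\<close> with initial value \<open>u0\<close> is by definition the sum of the
  exponential series, for each time \<open>t \<ge> 0\<close>.  The series is taken in the Banach space
  \<open>L\<^sup>1\<close>; thus \<open>u t\<close> is an arbitrary representative of its sum.  The extended
  nonnegative integral is used because the Bochner integral of a non-integrable function is 0.
\<close>

definition is_solution ::
  "('a::euclidean_space \<Rightarrow> complex) \<Rightarrow> real \<Rightarrow> ('a \<Rightarrow> complex) \<Rightarrow> (real \<Rightarrow> 'a \<Rightarrow> complex) \<Rightarrow> bool" where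
  "is_solution J \<chi>0 u0 u \<longleftrightarrow>
     (\<forall>t\<ge>0. integrable lebesgue (u t) \<and>
       (\<lambda>m. \<integral>\<^sup>+ x. ennreal (norm (u t x - exp_partial_sum J \<chi>0 u0 m t x)) \<partial>lebesgue)
         \<longlonglongrightarrow> 0)"

lemma ex_borel_complex:
  fixes f :: "'a::euclidean_space \<Rightarrow> complex"
  assumes "f \<in> borel_measurable lebesgue"
  shows "\<exists>g\<in>borel_measurable borel. AE x in lebesgue. f x = g x"
proof -
  obtain a where a: "a \<in> borel_measurable lborel" "AE x in lborel. Re (f x) = a x"
    using completion_ex_borel_measurable_real[of "\<lambda>x. Re (f x)" lborel] assms by auto
  obtain b where b: "b \<in> borel_measurable lborel" "AE x in lborel. Im (f x) = b x"
    using completion_ex_borel_measurable_real[of "\<lambda>x. Im (f x)" lborel] assms by auto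
  have [measurable]: "a \<in> borel_measurable borel" "b \<in> borel_measurable borel"
    using a(1) b(1) by simp_all
  have 1: "(\<lambda>x. complex_of_real (a x) + \<i> * complex_of_real (b x)) \<in> borel_measurable borel"
    by measurable
  have "AE x in lborel. f x = complex_of_real (a x) + \<i> * complex_of_real (b x)"
    using a(2) b(2) by eventually_elim (simp add: complex_eq_iff)
  then show ?thesis
    using 1 by (intro bexI[of _ "\<lambda>x. complex_of_real (a x) + \<i> * complex_of_real (b x)"] AE_completion)
qed

lemma measurable_lebesgue_cong_AE:
  fixes f g :: "'a::euclidean_space \<Rightarrow> complex"
  assumes f: "f \<in> borel_measurable lebesgue" and ae: "AE x in lebesgue. f x = g x"
  shows "g \<in> borel_measurable lebesgue"
proof (rule measurableI)
  fix A :: "complex set" assume A: "A \<in> sets borel"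
  show "g -` A \<inter> space lebesgue \<in> sets lebesgue"
  proof (rule completion.in_sets_AE)
    show "f -` A \<inter> space lebesgue \<in> sets lebesgue"
      using f A by (rule measurable_sets)
    show "AE x in lebesgue. x \<in> f -` A \<inter> space lebesgue \<longleftrightarrow> x \<in> g -` A \<inter> space lebesgue"
      using ae by eventually_elim simp
  qed simp
qed simp

lemma nn_integral_reflect:
  fixes f :: "'a::euclidean_space \<Rightarrow> ennreal"
  assumes [measurable]: "f \<in> borel_measurable borel"
  shows "(\<integral>\<^sup>+ y. f (x - y) \<partial>lborel) = integral\<^sup>N lborel f"
proof -
  have "integral\<^sup>N lborel f = integral\<^sup>N (density (distr lborel borel (\<lambda>y. x + (-1) *\<^sub>R y)) (\<lambda>_. ennreal (\<bar>-1\<bar> ^ DIM('a)))) f"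
    using lborel_affine[of "-1" x] by simp
  also have "\<dots> = (\<integral>\<^sup>+ y. f (x - y) \<partial>lborel)"
    by (simp add: nn_integral_density nn_integral_distr)
  finally show ?thesis by simp
qed

lemma nn_integral_shift:
  fixes f :: "'a::euclidean_space \<Rightarrow> ennreal"
  assumes [measurable]: "f \<in> borel_measurable borel"
  shows "(\<integral>\<^sup>+ y. f (y - x) \<partial>lborel) = integral\<^sup>N lborel f"
proof -
  have "integral\<^sup>N lborel f = integral\<^sup>N (distr lborel borel (\<lambda>y. - x + y)) f"
    by (simp only: lborel_distr_plus)
  also have "\<dots> = (\<integral>\<^sup>+ y. f (y - x) \<partial>lborel)"
    by (simp add: nn_integral_distr)
  finally show ?thesis by simp
qed

lemma AE_reflect_lebesgue:
  fixes x :: "'a::euclidean_space"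
  assumes "AE z in lebesgue. P z"
  shows "AE y in lebesgue. P (x - y)"
proof -
  have "AE z in lborel. P z" using assms by (simp add: AE_completion_iff)
  then obtain N where N: "N \<in> null_sets lborel" "{z. \<not> P z} \<subseteq> N"
    by (auto simp: eventually_ae_filter)
  then have [measurable]: "N \<in> sets borel" by auto
  have "(\<integral>\<^sup>+ y. indicator N (x - y) \<partial>lborel) = emeasure lborel N"
    by (subst nn_integral_reflect) auto
  then have "(\<integral>\<^sup>+ y. indicator N (x - y) \<partial>lborel) = 0" using N by auto
  then have "AE y in lborel. (indicator N (x - y) :: ennreal) = 0"
    by (subst (asm) nn_integral_0_iff_AE) auto
  then have "AE y in lborel. P (x - y)"
    by eventually_elim (use N in \<open>auto split: split_indicator_asm\<close>)
  then show ?thesis by (rule AE_completion)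
qed

lemma conv_op_L1:
  fixes J u :: "'a::euclidean_space \<Rightarrow> complex"
  assumes J: "integrable lebesgue J" and u: "integrable lebesgue u"
  shows "integrable lebesgue (conv_op J u)"
    and "(\<integral>\<^sup>+ x. ennreal (norm (conv_op J u x)) \<partial>lebesgue) \<le>
      (\<integral>\<^sup>+ x. ennreal (norm (J x)) \<partial>lebesgue) * (\<integral>\<^sup>+ x. ennreal (norm (u x)) \<partial>lebesgue)"
proof -
  obtain K where [measurable]: "K \<in> borel_measurable borel" and K: "AE x in lebesgue. J x = K x"
    using ex_borel_complex[of J] J by auto
  obtain v where [measurable]: "v \<in> borel_measurable borel" and v: "AE x in lebesgue. u x = v x"
    using ex_borel_complex[of u] u by auto
  have eq: "conv_op J u x = (LINT y|lborel. K (x - y) * v y)" for x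
  proof -
    have ae: "AE y in lebesgue. J (x - y) * u y = K (x - y) * v y"
      using AE_reflect_lebesgue[OF K, of x] v by eventually_elim simp
    have "conv_op J u x = (LINT y|lebesgue. K (x - y) * v y)"
      unfolding conv_op_def
    proof (intro integral_cong_AE)
      show "(\<lambda>y. K (x - y) * v y) \<in> borel_measurable lebesgue"
        by (intro measurable_completion) measurable
      then show "(\<lambda>y. J (x - y) * u y) \<in> borel_measurable lebesgue"
        by (rule measurable_lebesgue_cong_AE) (use ae in eventually_elim, simp)
    qed (fact ae)
    also have "\<dots> = (LINT y|lborel. K (x - y) * v y)"
      by (intro integral_completion) measurable
    finally show ?thesis .
  qed
  have [measurable]: "(\<lambda>x. LINT y|lborel. K (x - y) * v y) \<in> borel_measurable lborel"
    by measurable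
  then have meas: "conv_op J u \<in> borel_measurable lebesgue"
    unfolding eq[abs_def] by (rule measurable_completion)
  have "(\<integral>\<^sup>+ x. ennreal (norm (conv_op J u x)) \<partial>lebesgue)
      = (\<integral>\<^sup>+ x. ennreal (norm (LINT y|lborel. K (x - y) * v y)) \<partial>lborel)"
    unfolding eq by (intro nn_integral_completion) 
  also have "\<dots> \<le> (\<integral>\<^sup>+ x. \<integral>\<^sup>+ y. ennreal (norm (K (x - y)) * norm (v y)) \<partial>lborel \<partial>lborel)"
  proof (intro nn_integral_mono)
    fix x :: 'a
    show "ennreal (norm (LINT y|lborel. K (x - y) * v y)) \<le> (\<integral>\<^sup>+ y. ennreal (norm (K (x - y)) * norm (v y)) \<partial>lborel)"
    proof (cases "integrable lborel (\<lambda>y. K (x - y) * v y)")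
      case True
      from integral_norm_bound_ennreal[OF this] show ?thesis by (simp add: norm_mult)
    qed (simp add: not_integrable_integral_eq)
  qed
  also have "\<dots> = (\<integral>\<^sup>+ y. \<integral>\<^sup>+ x. ennreal (norm (K (x - y)) * norm (v y)) \<partial>lborel \<partial>lborel)"
    by (rule lborel_pair.Fubini') measurable
  also have "\<dots> = (\<integral>\<^sup>+ y. (\<integral>\<^sup>+ x. ennreal (norm (K x)) \<partial>lborel) * ennreal (norm (v y)) \<partial>lborel)"
    by (intro nn_integral_cong)
      (simp add: ennreal_mult nn_integral_multc nn_integral_shift[where f="\<lambda>z. ennreal (norm (K z))"])
  also have "\<dots> = (\<integral>\<^sup>+ x. ennreal (norm (K x)) \<partial>lborel) * (\<integral>\<^sup>+ x. ennreal (norm (v x)) \<partial>lborel)"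
    by (simp add: nn_integral_cmult)
  also have "\<dots> = (\<integral>\<^sup>+ x. ennreal (norm (K x)) \<partial>lebesgue) * (\<integral>\<^sup>+ x. ennreal (norm (v x)) \<partial>lebesgue)"
    by (simp add: nn_integral_completion)
  also have "\<dots> = (\<integral>\<^sup>+ x. ennreal (norm (J x)) \<partial>lebesgue) * (\<integral>\<^sup>+ x. ennreal (norm (u x)) \<partial>lebesgue)"
    by (intro arg_cong2[where f="(*)"] nn_integral_cong_AE)
      (use K v in \<open>auto elim: eventually_mono\<close>)
  finally show le: "(\<integral>\<^sup>+ x. ennreal (norm (conv_op J u x)) \<partial>lebesgue) \<le>
      (\<integral>\<^sup>+ x. ennreal (norm (J x)) \<partial>lebesgue) * (\<integral>\<^sup>+ x. ennreal (norm (u x)) \<partial>lebesgue)" .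
  also have "\<dots> < \<infinity>"
    using J u by (auto simp: integrable_iff_bounded ennreal_mult_less_top)
  finally show "integrable lebesgue (conv_op J u)"
    using meas by (simp add: integrable_iff_bounded)
qed

lemma conv_op_power_L1:
  fixes J u :: "'a::euclidean_space \<Rightarrow> complex"
  assumes J: "integrable lebesgue J" and u: "integrable lebesgue u"
  shows "integrable lebesgue ((conv_op J ^^ k) u) \<and>
    (\<integral>\<^sup>+ x. ennreal (norm ((conv_op J ^^ k) u x)) \<partial>lebesgue) \<le>
      (\<integral>\<^sup>+ x. ennreal (norm (J x)) \<partial>lebesgue) ^ k * (\<integral>\<^sup>+ x. ennreal (norm (u x)) \<partial>lebesgue)"
proof (induction k)
  case 0
  then show ?case using u by simp
next
  case (Suc k)
  then have int: "integrable lebesgue ((conv_op J ^^ k) u)" by simp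
  have "(\<integral>\<^sup>+ x. ennreal (norm ((conv_op J ^^ Suc k) u x)) \<partial>lebesgue) \<le>
      (\<integral>\<^sup>+ x. ennreal (norm (J x)) \<partial>lebesgue) * (\<integral>\<^sup>+ x. ennreal (norm ((conv_op J ^^ k) u x)) \<partial>lebesgue)"
    using conv_op_L1(2)[OF J int] by simp
  also have "\<dots> \<le> (\<integral>\<^sup>+ x. ennreal (norm (J x)) \<partial>lebesgue) *
      ((\<integral>\<^sup>+ x. ennreal (norm (J x)) \<partial>lebesgue) ^ k * (\<integral>\<^sup>+ x. ennreal (norm (u x)) \<partial>lebesgue))"
    using Suc by (intro mult_left_mono) simp_all
  finally show ?case
    using conv_op_L1(1)[OF J int] by (simp add: mult.assoc)
qed

text \<open>
  For integrable data a solution exists: the series converges absolutely almost everywhere,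
  and its pointwise sum is a representative of the \<open>L\<^sup>1\<close> sum.
\<close>

lemma is_solution_exists:
  fixes J u0 :: "'a::euclidean_space \<Rightarrow> complex"
  assumes J: "integrable lebesgue J" and u0: "integrable lebesgue u0"
  shows "is_solution J \<chi>0 u0
    (\<lambda>t x. of_real (exp (- \<chi>0 * t)) * (\<Sum>k. of_real (t ^ k / fact k) * (conv_op J ^^ k) u0 x))"
  unfolding is_solution_def
proof (intro allI impI)
  fix t :: real assume t: "0 \<le> t"
  define f where "f k x = complex_of_real (t ^ k / fact k) * (conv_op J ^^ k) u0 x" for k x
  define c where "c = complex_of_real (exp (- \<chi>0 * t))"
  define a where "a = enn2real (\<integral>\<^sup>+ x. ennreal (norm (J x)) \<partial>lebesgue)"
  define b where "b = enn2real (\<integral>\<^sup>+ x. ennreal (norm (u0 x)) \<partial>lebesgue)"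
  have a: "(\<integral>\<^sup>+ x. ennreal (norm (J x)) \<partial>lebesgue) = ennreal a" "0 \<le> a"
    and b: "(\<integral>\<^sup>+ x. ennreal (norm (u0 x)) \<partial>lebesgue) = ennreal b" "0 \<le> b"
    using J u0 unfolding a_def b_def by (auto simp: integrable_iff_bounded less_top)
  have int: "integrable lebesgue (f k)" for k
    unfolding f_def using conv_op_power_L1[OF J u0, of k] by (intro integrable_mult_right) auto
  have [measurable]: "f k \<in> borel_measurable lebesgue" for k
    using int[of k] by auto
  have bound: "(\<integral>\<^sup>+ x. ennreal (norm (f k x)) \<partial>lebesgue) \<le> ennreal ((t * a) ^ k / fact k * b)" for k
  proof -
    have [measurable]: "(conv_op J ^^ k) u0 \<in> borel_measurable lebesgue"
      using conv_op_power_L1[OF J u0, of k] by auto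
    have "(\<integral>\<^sup>+ x. ennreal (norm (f k x)) \<partial>lebesgue)
      = ennreal (t ^ k / fact k) * (\<integral>\<^sup>+ x. ennreal (norm ((conv_op J ^^ k) u0 x)) \<partial>lebesgue)"
    proof -
      have "ennreal (norm (f k x)) = ennreal (t ^ k / fact k) * ennreal (norm ((conv_op J ^^ k) u0 x))" for x
      proof -
        have "norm (complex_of_real (t ^ k / fact k)) = t ^ k / fact k"
          unfolding norm_of_real using t by simp
        then show ?thesis using t by (simp only: f_def norm_mult) (simp add: ennreal_mult[symmetric])
      qed
      then show ?thesis by (simp add: nn_integral_cmult)
    qed
    also have "\<dots> \<le> ennreal (t ^ k / fact k) * (ennreal a ^ k * ennreal b)"
      using conv_op_power_L1[OF J u0, of k] a b by (intro mult_left_mono) auto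
    also have "\<dots> = ennreal ((t * a) ^ k / fact k * b)"
      using a b t by (simp add: ennreal_power ennreal_mult[symmetric] power_mult_distrib)
    finally show ?thesis .
  qed
  have sm: "summable (\<lambda>k. (t * a) ^ k / fact k * b)"
    using summable_exp_generic[of "t * a"] by (intro summable_mult2) (simp add: divide_inverse mult.commute)
  have "(\<integral>\<^sup>+ x. (\<Sum>k. ennreal (norm (f k x))) \<partial>lebesgue) = (\<Sum>k. \<integral>\<^sup>+ x. ennreal (norm (f k x)) \<partial>lebesgue)"
    by (rule nn_integral_suminf) auto
  also have "\<dots> \<le> (\<Sum>k. ennreal ((t * a) ^ k / fact k * b))"
    by (intro suminf_le bound) auto
  also have "\<dots> = ennreal (\<Sum>k. (t * a) ^ k / fact k * b)"
    using sm a b t by (intro suminf_ennreal2) auto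
  finally have fin: "(\<integral>\<^sup>+ x. (\<Sum>k. ennreal (norm (f k x))) \<partial>lebesgue) < \<infinity>"
    by (rule le_less_trans) simp
  then have "AE x in lebesgue. (\<Sum>k. ennreal (norm (f k x))) \<noteq> \<infinity>"
    by (intro nn_integral_noteq_infinite) auto
  then have ae: "AE x in lebesgue. summable (\<lambda>k. norm (f k x))"
    by eventually_elim (auto intro: summable_suminf_not_top)
  have g: "integrable lebesgue (\<lambda>x. \<Sum>k. norm (f k x))"
  proof (rule integrableI_bounded)
    show "(\<lambda>x. \<Sum>k. norm (f k x)) \<in> borel_measurable lebesgue" by measurable
    have "(\<integral>\<^sup>+ x. ennreal (norm (\<Sum>k. norm (f k x))) \<partial>lebesgue)
      = (\<integral>\<^sup>+ x. (\<Sum>k. ennreal (norm (f k x))) \<partial>lebesgue)"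
      by (rule nn_integral_cong_AE, use ae in eventually_elim)
        (simp add: suminf_ennreal2 suminf_nonneg)
    then show "(\<integral>\<^sup>+ x. ennreal (norm (\<Sum>k. norm (f k x))) \<partial>lebesgue) < \<infinity>" using fin by simp
  qed
  have ms: "(\<lambda>x. \<Sum>k. f k x) \<in> borel_measurable lebesgue" by measurable
  have S: "integrable lebesgue (\<lambda>x. \<Sum>k. f k x)"
    by (rule Bochner_Integration.integrable_bound[OF g ms], use ae in eventually_elim)
      (simp add: summable_norm suminf_nonneg)
  have conv: "(\<lambda>m. \<integral>\<^sup>+ x. ennreal (norm (c * (\<Sum>k. f k x) - c * (\<Sum>k<m. f k x))) \<partial>lebesgue)
      \<longlonglongrightarrow> (\<integral>\<^sup>+ x. 0 \<partial>(lebesgue :: 'a measure))"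
  proof (rule nn_integral_dominated_convergence[where w="\<lambda>x. ennreal (norm c * (2 * (\<Sum>k. norm (f k x))))"])
    show "(\<integral>\<^sup>+ x. ennreal (norm c * (2 * (\<Sum>k. norm (f k x)))) \<partial>lebesgue) < \<infinity>"
    proof -
      have "integrable lebesgue (\<lambda>x. norm c * (2 * (\<Sum>k. norm (f k x))))" using g by auto
      then have *: "(\<integral>\<^sup>+ x. ennreal (norm (norm c * (2 * (\<Sum>k. norm (f k x))))) \<partial>lebesgue) < \<infinity>"
        by (simp only: integrable_iff_bounded)
      show ?thesis
        by (rule le_less_trans[OF nn_integral_mono *]) (auto intro!: ennreal_leI)
    qed
    show "AE x in lebesgue. ennreal (norm (c * (\<Sum>k. f k x) - c * (\<Sum>k<m. f k x)))
        \<le> ennreal (norm c * (2 * (\<Sum>k. norm (f k x))))" for m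
      using ae
    proof eventually_elim
      case (elim x)
      have "norm ((\<Sum>k. f k x) - (\<Sum>k<m. f k x)) \<le> norm (\<Sum>k. f k x) + norm (\<Sum>k<m. f k x)"
        by (rule norm_triangle_ineq4)
      also have "\<dots> \<le> (\<Sum>k. norm (f k x)) + (\<Sum>k. norm (f k x))"
        using elim by (intro add_mono summable_norm order_trans[OF norm_sum sum_le_suminf]) auto
      finally show ?case
        by (intro ennreal_leI) (simp add: right_diff_distrib[symmetric] norm_mult mult_left_mono)
    qed
    show "AE x in lebesgue. (\<lambda>m. ennreal (norm (c * (\<Sum>k. f k x) - c * (\<Sum>k<m. f k x)))) \<longlonglongrightarrow> 0"
      using ae
    proof eventually_elim
      case (elim x)
      have "(\<lambda>m. \<Sum>k<m. f k x) \<longlonglongrightarrow> (\<Sum>k. f k x)"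
        using summable_norm_cancel[OF elim] by (rule summable_LIMSEQ)
      then have "(\<lambda>m. norm (c * (\<Sum>k. f k x) - c * (\<Sum>k<m. f k x))) \<longlonglongrightarrow>
          norm (c * (\<Sum>k. f k x) - c * (\<Sum>k. f k x))"
        by (intro tendsto_intros)
      then have "(\<lambda>m. norm (c * (\<Sum>k. f k x) - c * (\<Sum>k<m. f k x))) \<longlonglongrightarrow> 0"
        by (simp only: diff_self norm_zero)
      from tendsto_ennrealI[OF this] show ?case
        by (simp only: ennreal_0)
    qed
  qed simp_all
  show "integrable lebesgue (\<lambda>x. of_real (exp (- \<chi>0 * t)) * (\<Sum>k. of_real (t ^ k / fact k) * (conv_op J ^^ k) u0 x)) \<and>
    (\<lambda>m. \<integral>\<^sup>+ x. ennreal (norm (of_real (exp (- \<chi>0 * t)) * (\<Sum>k. of_real (t ^ k / fact k) * (conv_op J ^^ k) u0 x)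
        - exp_partial_sum J \<chi>0 u0 m t x)) \<partial>lebesgue) \<longlonglongrightarrow> 0"
    using integrable_mult_right[OF S, of c] conv
    unfolding exp_partial_sum_def f_def[symmetric] c_def[symmetric] nn_integral_const mult_zero_left by (rule conjI)
qed

end

theory Submission
  imports Defs
begin

text \<open>
  Put \<open>f = |J|\<close>, a probability density. The iterates \<open>\<J>\<^sup>k u0\<close> are dominated pointwise by the
  iterated convolutions of \<open>f\<close> with \<open>|u0|\<close>, so everything reduces to one estimate on
  nonnegative functions: the \<open>k\<close>-fold convolution \<open>f\<^sup>*\<^sup>k\<close> is bounded by a multiple of \<open>k\<^sup>-\<^sup>n\<^sup>/\<^sup>2\<close> for all
  \<open>k \<ge> N\<close>. Averaging this bound against the Poisson weights \<open>e\<^sup>-\<^sup>t t\<^sup>k / k!\<close> gives \<open>t\<^sup>-\<^sup>n\<^sup>/\<^sup>2\<close>,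
  and the bound survives the passage to the \<open>L\<^sup>1\<close> limit that defines the solution. The terms with
  \<open>k < N\<close> may be unbounded; they are exactly the ones that are subtracted.

  The kernel estimate (\<open>nn_conv_power_decay\<close>) is obtained without the Fourier transform, by a
  decomposition in the spirit of Doeblin.

  First, \<open>f\<^sup>*\<^sup>N\<close> is bounded (\<open>nn_conv_power_bounded\<close>); for \<open>\<epsilon>0 = \<infinity>\<close> this is the hypothesis.
  In the multiple integral for \<open>f\<^sup>*\<^sup>N(x)\<close> the smallest of the \<open>N\<close> factors is at most the geometric
  mean of the others, so the product is at most a product of \<open>N - 1\<close> factors \<open>f\<^sup>q\<close> with
  \<open>q = N/(N-1) \<le> 1 + \<epsilon>0\<close>; each of these is integrable in its own variable.

  Secondly, \<open>f * f\<close> is bounded below by a multiple of the indicator of a box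
  (\<open>nn_conv_ge_box\<close>), an instance of the theorem of Steinhaus on difference sets. Hence
  \<open>f * f = c U + R\<close> with \<open>U\<close> the indicator of a box, \<open>R \<ge> 0\<close> and \<open>c \<integral>U + \<integral>R = 1\<close>.

  Thirdly, box indicators satisfy the estimate by explicit computation
  (\<open>nn_conv_box_power_le\<close>): coordinates separate, and in one dimension the indicator of an interval
  is the sum of two adjacent half-intervals. Expanding the convolution power by the binomial
  theorem gives the distribution of a fair binomial variable, whose largest atom is of order
  \<open>i\<^sup>-\<^sup>1\<^sup>/\<^sup>2\<close>, times convolutions of half-intervals whose lattice translates add up to a bounded
  function.

  Finally \<open>(c U + R)\<^sup>*\<^sup>m\<close> is expanded: the number of factors \<open>U\<close> is binomially distributed with mean
  proportional to \<open>m\<close>, so the average of the box bounds is again of order \<open>m\<^sup>-\<^sup>n\<^sup>/\<^sup>2\<close>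
  (\<open>binomial_expectation_decay\<close>). The contribution without any factor \<open>U\<close> is where the
  boundedness of \<open>f\<^sup>*\<^sup>N\<close> is used.
\<close>

section \<open>Convolution of nonnegative functions\<close>

text \<open>
  Values in the extended nonnegative reals make convolution total: associativity, commutativity and
  the binomial expansions below hold without integrability conditions.
\<close>

definition nn_conv :: "('a::euclidean_space \<Rightarrow> ennreal) \<Rightarrow> ('a \<Rightarrow> ennreal) \<Rightarrow> 'a \<Rightarrow> ennreal" where
  "nn_conv f g = (\<lambda>x. \<integral>\<^sup>+ y. f (x - y) * g y \<partial>lborel)"

lemma measurable_nn_conv [measurable]:
  assumes [measurable]: "f \<in> borel_measurable borel" "g \<in> borel_measurable borel"
  shows "nn_conv f g \<in> borel_measurable borel"
proof -
  have "(\<lambda>x. \<integral>\<^sup>+ y. f (x - y) * g y \<partial>lborel) \<in> borel_measurable lborel" by measurable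
  then show ?thesis by (simp add: nn_conv_def)
qed

lemma measurable_nn_conv_power [measurable]:
  assumes "f \<in> borel_measurable borel" "g \<in> borel_measurable borel"
  shows "(nn_conv f ^^ k) g \<in> borel_measurable borel"
  using assms by (induction k) auto

lemma nn_conv_commute:
  assumes [measurable]: "f \<in> borel_measurable borel" "g \<in> borel_measurable borel"
  shows "nn_conv f g = nn_conv g f"
proof
  fix x
  show "nn_conv f g x = nn_conv g f x"
    using nn_integral_reflect[of "\<lambda>y. f (x - y) * g y" x] by (simp add: nn_conv_def mult.commute)
qed

lemma nn_conv_assoc:
  assumes [measurable]: "f \<in> borel_measurable borel" "g \<in> borel_measurable borel" "h \<in> borel_measurable borel"
  shows "nn_conv (nn_conv f g) h = nn_conv f (nn_conv g h)"
proof
  fix x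
  have "nn_conv (nn_conv f g) h x = (\<integral>\<^sup>+ y. \<integral>\<^sup>+ z. f (x - y - z) * g z * h y \<partial>lborel \<partial>lborel)"
    unfolding nn_conv_def by (simp add: nn_integral_multc)
  also have "\<dots> = (\<integral>\<^sup>+ y. \<integral>\<^sup>+ z. f (x - z) * g (z - y) * h y \<partial>lborel \<partial>lborel)"
  proof (rule nn_integral_cong)
    fix y
    show "(\<integral>\<^sup>+ z. f (x - y - z) * g z * h y \<partial>lborel) = (\<integral>\<^sup>+ z. f (x - z) * g (z - y) * h y \<partial>lborel)"
      using nn_integral_shift[of "\<lambda>z. f (x - y - z) * g z * h y" y] by simp
  qed
  also have "\<dots> = (\<integral>\<^sup>+ z. \<integral>\<^sup>+ y. f (x - z) * g (z - y) * h y \<partial>lborel \<partial>lborel)"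
    by (rule lborel_pair.Fubini') measurable
  also have "\<dots> = nn_conv f (nn_conv g h) x"
    unfolding nn_conv_def by (simp add: nn_integral_cmult[symmetric] mult.assoc)
  finally show "nn_conv (nn_conv f g) h x = nn_conv f (nn_conv g h) x" .
qed

lemma nn_conv_left_commute:
  assumes "f \<in> borel_measurable borel" "g \<in> borel_measurable borel" "h \<in> borel_measurable borel"
  shows "nn_conv f (nn_conv g h) = nn_conv g (nn_conv f h)"
  using assms by (metis nn_conv_assoc nn_conv_commute)

lemma nn_conv_power_commute:
  assumes [measurable]: "f \<in> borel_measurable borel" "g \<in> borel_measurable borel" "h \<in> borel_measurable borel"
  shows "(nn_conv f ^^ k) (nn_conv g h) = nn_conv g ((nn_conv f ^^ k) h)"
proof (induction k)
  case (Suc k)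
  then show ?case using nn_conv_left_commute[of f g "(nn_conv f ^^ k) h"] by simp
qed simp

lemma nn_conv_power_assoc:
  assumes [measurable]: "f \<in> borel_measurable borel" "g \<in> borel_measurable borel" "h \<in> borel_measurable borel"
  shows "nn_conv ((nn_conv f ^^ k) g) h = (nn_conv f ^^ k) (nn_conv g h)"
proof (induction k)
  case (Suc k)
  then show ?case using nn_conv_assoc[of f "(nn_conv f ^^ k) g" h] by simp
qed simp

lemma nn_integral_nn_conv:
  assumes [measurable]: "f \<in> borel_measurable borel" "g \<in> borel_measurable borel"
  shows "(\<integral>\<^sup>+ x. nn_conv f g x \<partial>lborel) = (\<integral>\<^sup>+ x. f x \<partial>lborel) * (\<integral>\<^sup>+ x. g x \<partial>lborel)"
proof -
  have "(\<integral>\<^sup>+ x. nn_conv f g x \<partial>lborel) = (\<integral>\<^sup>+ y. \<integral>\<^sup>+ x. f (x - y) * g y \<partial>lborel \<partial>lborel)"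
    unfolding nn_conv_def by (rule lborel_pair.Fubini') measurable
  also have "\<dots> = (\<integral>\<^sup>+ y. (\<integral>\<^sup>+ x. f x \<partial>lborel) * g y \<partial>lborel)"
    by (simp add: nn_integral_multc nn_integral_shift[of f])
  finally show ?thesis by (simp add: nn_integral_cmult)
qed

lemma nn_conv_le:
  assumes [measurable]: "f \<in> borel_measurable borel" "g \<in> borel_measurable borel"
    and "\<And>x. g x \<le> c"
  shows "nn_conv f g x \<le> c * (\<integral>\<^sup>+ x. f x \<partial>lborel)"
proof -
  have "nn_conv f g x \<le> (\<integral>\<^sup>+ y. c * f (x - y) \<partial>lborel)"
    unfolding nn_conv_def by (subst mult.commute, intro nn_integral_mono mult_right_mono assms) simp
  also have "\<dots> = c * (\<integral>\<^sup>+ x. f x \<partial>lborel)"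
    by (simp add: nn_integral_cmult nn_integral_reflect)
  finally show ?thesis .
qed

lemma nn_conv_power_le:
  assumes [measurable]: "f \<in> borel_measurable borel" "g \<in> borel_measurable borel"
    and 1: "(\<integral>\<^sup>+ x. f x \<partial>lborel) = 1" and "\<And>x. g x \<le> c"
  shows "(nn_conv f ^^ k) g x \<le> c"
proof (induction k arbitrary: x)
  case (Suc k)
  then show ?case using nn_conv_le[of f "(nn_conv f ^^ k) g" c x] 1 by simp
qed (simp add: assms)

lemma nn_conv_add_left:
  assumes [measurable]: "f \<in> borel_measurable borel" "g \<in> borel_measurable borel" "h \<in> borel_measurable borel"
  shows "nn_conv (\<lambda>x. f x + g x) h x = nn_conv f h x + nn_conv g h x"
  unfolding nn_conv_def by (simp add: distrib_right nn_integral_add)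

lemma nn_conv_cmult_left:
  assumes [measurable]: "f \<in> borel_measurable borel" "h \<in> borel_measurable borel"
  shows "nn_conv (\<lambda>x. c * f x) h x = c * nn_conv f h x"
  unfolding nn_conv_def by (simp add: mult.assoc nn_integral_cmult)

lemma nn_conv_translate_left: "nn_conv (\<lambda>x. f (x - s)) h x = nn_conv f h (x - s)"
  unfolding nn_conv_def by (simp add: algebra_simps)

lemma nn_conv_translate_right:
  assumes [measurable]: "f \<in> borel_measurable borel" "h \<in> borel_measurable borel"
  shows "nn_conv f (\<lambda>x. h (x - s)) x = nn_conv f h (x - s)"
proof -
  have "nn_conv f (\<lambda>x. h (x - s)) x = nn_conv (\<lambda>x. h (x - s)) f x"
    by (subst nn_conv_commute) auto
  then show ?thesis by (simp add: nn_conv_translate_left nn_conv_commute[of h f])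
qed

lemma nn_conv_sum_right:
  assumes [measurable]: "f \<in> borel_measurable borel" "\<And>i. i \<in> I \<Longrightarrow> h i \<in> borel_measurable borel"
  shows "nn_conv f (\<lambda>x. \<Sum>i\<in>I. h i x) x = (\<Sum>i\<in>I. nn_conv f (h i) x)"
  unfolding nn_conv_def by (simp add: sum_distrib_left nn_integral_sum)

lemma nn_conv_power_sum_translate:
  assumes [measurable]: "f \<in> borel_measurable borel" "h \<in> borel_measurable borel"
  shows "(nn_conv f ^^ k) (\<lambda>x. \<Sum>i\<in>I. h (x - s i)) x = (\<Sum>i\<in>I. (nn_conv f ^^ k) h (x - s i))"
proof (induction k arbitrary: x)
  case (Suc k)
  have *: "(nn_conv f ^^ k) (\<lambda>x. \<Sum>i\<in>I. h (x - s i)) = (\<lambda>x. \<Sum>i\<in>I. (nn_conv f ^^ k) h (x - s i))"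
    using Suc by auto
  show ?case
    by (simp add: * nn_conv_sum_right nn_conv_translate_right)
qed simp

lemma nn_conv_power_double:
  assumes [measurable]: "f \<in> borel_measurable borel" "g \<in> borel_measurable borel"
  shows "(nn_conv (nn_conv f f) ^^ m) g = (nn_conv f ^^ (2 * m)) g"
proof (induction m)
  case (Suc m)
  then show ?case
    using nn_conv_assoc[of f f "(nn_conv f ^^ (2 * m)) g"] by simp
qed simp

text \<open>
  Young's inequality for \<open>L\<^sup>1 * L\<^sup>\<infinity>\<close>: a uniform bound on the kernel of the iterated operator
  is a bound for it from \<open>L\<^sup>1\<close> to \<open>L\<^sup>\<infinity>\<close>.
\<close>

lemma nn_conv_power_le_of_kernel:
  assumes [measurable]: "f \<in> borel_measurable borel" "g \<in> borel_measurable borel"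
    and B: "\<And>x. (nn_conv f ^^ k) f x \<le> B"
  shows "(nn_conv f ^^ Suc k) g x \<le> B * (\<integral>\<^sup>+ x. g x \<partial>lborel)"
proof -
  have "(nn_conv f ^^ Suc k) g = nn_conv ((nn_conv f ^^ k) f) g"
    by (simp add: nn_conv_power_assoc funpow_swap1)
  also have "\<dots> = nn_conv g ((nn_conv f ^^ k) f)"
    by (rule nn_conv_commute) auto
  finally show ?thesis by (simp add: nn_conv_le B)
qed

section \<open>Convolution powers of a box\<close>

lemma sum_binomial_Suc:
  fixes x :: "nat \<Rightarrow> 'a::comm_semiring_1"
  shows "(\<Sum>b\<le>Suc m. of_nat (Suc m choose b) * x b) = (\<Sum>b\<le>m. of_nat (m choose b) * (x b + x (Suc b)))"
proof -
  have "(\<Sum>b\<le>Suc m. of_nat (Suc m choose b) * x b) =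
      x 0 + (\<Sum>b\<le>m. of_nat (m choose b) * x (Suc b) + of_nat (m choose Suc b) * x (Suc b))"
    by (simp only: sum.atMost_Suc_shift) (simp add: distrib_right)
  also have "\<dots> = (\<Sum>b\<le>m. of_nat (m choose b) * x (Suc b)) + (\<Sum>b\<le>Suc m. of_nat (m choose b) * x b)"
    by (simp only: sum.atMost_Suc_shift) (simp add: sum.distrib add_ac)
  also have "(\<Sum>b\<le>Suc m. of_nat (m choose b) * x b) = (\<Sum>b\<le>m. of_nat (m choose b) * x b)"
    by (simp add: binomial_eq_0)
  finally show ?thesis by (simp add: sum.distrib distrib_left add_ac)
qed

text \<open>
  The order \<open>i\<^sup>-\<^sup>1\<^sup>/\<^sup>2\<close> of the largest atom of the fair binomial distribution. For even \<open>i\<close> it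
  follows by induction, since \<open>(2m+1)(2m+3) \<le> (2m+2)\<^sup>2\<close>; an odd central coefficient is half of
  the next even one.
\<close>

lemma central_binomial_le: "real (i choose (i div 2)) \<le> 2 ^ i / sqrt (real i + 1)"
proof -
  have even: "real ((2 * m) choose m) \<le> 4 ^ m / sqrt (2 * real m + 1)" for m
  proof (induction m)
    case (Suc m)
    have "real (Suc m) * real (2 * Suc m choose Suc m) = 2 * (2 * real m + 1) * real (2 * m choose m)"
    proof -
      have "Suc m * (2 * Suc m choose Suc m) = 2 * Suc m * (Suc (2 * m) choose m)"
        using Suc_times_binomial_eq[of "Suc (2 * m)" m] by (simp add: mult_ac)
      moreover have "Suc m * (Suc (2 * m) choose m) = Suc (2 * m) * (2 * m choose m)"
        using binomial_absorb_comp[of "Suc (2*m)" m] by (simp add: Suc_diff_le)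
      ultimately have "Suc m * (2 * Suc m choose Suc m) = 2 * (Suc (2 * m) * (2 * m choose m))"
        by (metis mult.assoc)
      then have "real (Suc m * (2 * Suc m choose Suc m)) = real (2 * (Suc (2 * m) * (2 * m choose m)))"
        by (simp only:)
      then show ?thesis by (simp only: of_nat_mult of_nat_Suc) (simp add: algebra_simps)
    qed
    also have "\<dots> \<le> 2 * (2 * real m + 1) * (4 ^ m / sqrt (2 * real m + 1))"
      using Suc by (intro mult_left_mono) auto
    also have "\<dots> = 2 * 4 ^ m * sqrt (2 * real m + 1)"
      by (simp add: field_simps)
    also have "\<dots> \<le> 2 * 4 ^ m * (2 * (real m + 1) / sqrt (2 * real (Suc m) + 1))"
    proof -
      have "sqrt (2 * real m + 1) * sqrt (2 * real (Suc m) + 1) \<le> 2 * (real m + 1)"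
        unfolding real_sqrt_mult[symmetric]
        by (rule real_le_lsqrt) (auto simp: power2_eq_square algebra_simps)
      then show ?thesis by (intro mult_left_mono) (auto simp: pos_le_divide_eq)
    qed
    finally have "real (Suc m) * real (2 * Suc m choose Suc m) \<le> real (Suc m) * (4 ^ Suc m / sqrt (2 * real (Suc m) + 1))"
      by (simp add: field_simps)
    then show ?case by (rule mult_left_le_imp_le) simp
  qed simp
  show ?thesis
  proof (cases "even i")
    case True
    then obtain m where "i = 2 * m" by blast
    then show ?thesis using even[of m] by (simp add: power_mult)
  next
    case False
    then obtain m where i: "i = 2 * m + 1" using oddE by blast
    have "i choose Suc m = i choose m"
      using central_binomial_odd[of i] False i by simp
    then have "2 * (i choose m) = (2 * Suc m) choose Suc m"
      using binomial_Suc_Suc[of i m] i by simp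
    then have "2 * real (i choose m) = real ((2 * Suc m) choose Suc m)"
      by (metis of_nat_mult of_nat_numeral)
    also have "\<dots> \<le> 4 ^ Suc m / sqrt (2 * real (Suc m) + 1)" by (rule even)
    also have "\<dots> \<le> 4 ^ Suc m / sqrt (real i + 1)"
      using i by (intro divide_left_mono) (auto intro!: mult_pos_pos)
    finally show ?thesis using i by (simp add: power_mult)
  qed
qed

text \<open>
  Convolution with \<open>w + w(\<cdot> - h)\<close> is convolution with \<open>w\<close> composed with identity plus translation
  by \<open>h\<close>; these commute, so the powers expand by the binomial theorem.
\<close>

lemma nn_conv_binomial:
  assumes [measurable]: "w \<in> borel_measurable borel" "g \<in> borel_measurable borel"
  shows "(nn_conv (\<lambda>x. w x + w (x - h)) ^^ i) g x =
    (\<Sum>b\<le>i. of_nat (i choose b) * (nn_conv w ^^ i) g (x - real b *\<^sub>R h))"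
proof (induction i arbitrary: x)
  case (Suc i)
  let ?u = "\<lambda>x. w x + w (x - h)"
  have *: "(nn_conv ?u ^^ i) g = (\<lambda>x. \<Sum>b\<le>i. of_nat (i choose b) * (nn_conv w ^^ i) g (x - real b *\<^sub>R h))"
    using Suc by auto
  have w: "nn_conv w ((nn_conv ?u ^^ i) g) x =
      (\<Sum>b\<le>i. of_nat (i choose b) * (nn_conv w ^^ Suc i) g (x - real b *\<^sub>R h))" for x
    unfolding * by (subst nn_conv_sum_right)
      (auto simp: nn_conv_commute[of w "\<lambda>x. of_nat _ * _ x"] nn_conv_cmult_left nn_conv_translate_left
        nn_conv_commute[of w "(nn_conv w ^^ i) g"])
  have "(nn_conv ?u ^^ Suc i) g x = nn_conv w ((nn_conv ?u ^^ i) g) x + nn_conv w ((nn_conv ?u ^^ i) g) (x - h)"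
    by (simp add: nn_conv_add_left nn_conv_translate_left)
  also have "\<dots> = (\<Sum>b\<le>i. of_nat (i choose b) * ((nn_conv w ^^ Suc i) g (x - real b *\<^sub>R h) +
      (nn_conv w ^^ Suc i) g (x - real (Suc b) *\<^sub>R h)))"
    unfolding w by (simp add: sum.distrib distrib_left algebra_simps)
  also have "\<dots> = (\<Sum>b\<le>Suc i. of_nat (Suc i choose b) * (nn_conv w ^^ Suc i) g (x - real b *\<^sub>R h))"
    by (rule sum_binomial_Suc[symmetric])
  finally show ?case .
qed simp

lemma sum_translates_interval:
  fixes h a x :: real
  assumes "0 \<le> h"
  shows "(\<Sum>b\<le>i. indicator {a..<a+h} (x - real b * h)) = (indicator {a..<a + real (Suc i) * h} x :: ennreal)"
proof (induction i)
  case (Suc i)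
  define c where "c = real i * h"
  have c: "0 \<le> c" "real (Suc i) * h = c + h" "real (Suc (Suc i)) * h = c + 2 * h"
    using assms by (auto simp: c_def algebra_simps)
  have "(\<Sum>b\<le>Suc i. indicator {a..<a+h} (x - real b * h)) =
     (indicator {a..<a + (c + h)} x + indicator {a..<a+h} (x - (c + h)) :: ennreal)"
    using Suc c by simp
  also have "\<dots> = indicator {a..<a + (c + 2 * h)} x"
    using assms c(1) by (auto simp: indicator_def)
  finally show ?case using c by simp
qed simp

text \<open>
  Splitting the interval into two halves replaces its \<open>i\<close>-fold convolution by a binomial
  combination of translates by multiples of \<open>h\<close>. Pulling out the largest binomial coefficient
  leaves the plain sum of these translates. That sum is bounded because the translates of a
  half-interval tile the line.
\<close>

lemma nn_conv_interval_power_le: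
  fixes a h x :: real
  assumes h: "0 < h"
  defines "u \<equiv> indicator {a..<a+2*h} :: real \<Rightarrow> ennreal"
  shows "(nn_conv u ^^ i) u x \<le> ennreal ((2 * h) ^ Suc i / (h * sqrt (real i + 1)))"
proof -
  define w where "w = (indicator {a..<a+h} :: real \<Rightarrow> ennreal)"
  have [measurable]: "w \<in> borel_measurable borel" "u \<in> borel_measurable borel"
    by (auto simp: w_def u_def)
  have u: "u = (\<lambda>x. w x + w (x - h))"
    using h by (auto simp: u_def w_def indicator_def)
  have W: "(\<integral>\<^sup>+ x. w x \<partial>lborel) = ennreal h"
    using h by (simp add: w_def)
  have tiles: "(\<Sum>b\<le>i. w (x - real b * h)) \<le> 1" for x
    using sum_translates_interval[of h a x i] h by (simp add: w_def indicator_def)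
  have "(\<Sum>b\<le>i. u (x - real b * h)) \<le> 2" for x
  proof -
    have "(\<Sum>b\<le>i. u (x - real b * h)) = (\<Sum>b\<le>i. w (x - real b * h)) + (\<Sum>b\<le>i. w (x - h - real b * h))"
      unfolding u by (simp add: sum.distrib algebra_simps)
    also have "\<dots> \<le> 1 + 1" by (intro add_mono tiles)
    finally show ?thesis by simp
  qed
  then have "(nn_conv w ^^ k) (\<lambda>x. \<Sum>b\<le>i. u (x - real b * h)) x \<le> ennreal (2 * h ^ k)" for k x
  proof (induction k arbitrary: x)
    case (Suc k)
    have "nn_conv w ((nn_conv w ^^ k) (\<lambda>x. \<Sum>b\<le>i. u (x - real b * h))) x \<le> ennreal (2 * h ^ k) * ennreal h"
      unfolding W[symmetric] by (rule nn_conv_le) (use Suc in auto)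
    then show ?case using h by (simp add: ennreal_mult[symmetric] mult_ac)
  qed simp
  then have tiled: "(\<Sum>b\<le>i. (nn_conv w ^^ i) u (x - real b * h)) \<le> ennreal (2 * h ^ i)"
    by (subst (asm) nn_conv_power_sum_translate) auto
  have "(nn_conv u ^^ i) u x = (\<Sum>b\<le>i. of_nat (i choose b) * (nn_conv w ^^ i) u (x - real b * h))"
    using nn_conv_binomial[where w=w and g=u and h=h and i=i and x=x] by (simp add: u[symmetric])
  also have "\<dots> \<le> (\<Sum>b\<le>i. ennreal (real (i choose (i div 2))) * (nn_conv w ^^ i) u (x - real b * h))"
    by (intro sum_mono mult_right_mono) (auto simp: ennreal_of_nat_eq_real_of_nat binomial_maximum)
  also have "\<dots> \<le> ennreal (2 ^ i / sqrt (real i + 1)) * ennreal (2 * h ^ i)"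
    unfolding sum_distrib_left[symmetric]
    by (intro mult_mono ennreal_leI central_binomial_le tiled) auto
  also have "\<dots> = ennreal ((2 * h) ^ Suc i / (h * sqrt (real i + 1)))"
    using h by (simp add: ennreal_mult[symmetric] power_mult_distrib)
  finally show ?thesis .
qed

text \<open>
  Lebesgue measure is a product measure, so convolution of functions that factor over the
  coordinates is done coordinatewise.
\<close>

lemma nn_conv_power_prod:
  fixes u v :: "'a::euclidean_space \<Rightarrow> real \<Rightarrow> ennreal"
  assumes [measurable]: "\<And>b. u b \<in> borel_measurable borel" "\<And>b. v b \<in> borel_measurable borel"
  shows "(nn_conv (\<lambda>x. \<Prod>b\<in>Basis. u b (x \<bullet> b)) ^^ i) (\<lambda>x. \<Prod>b\<in>Basis. v b (x \<bullet> b)) x =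
    (\<Prod>b\<in>Basis. (nn_conv (u b) ^^ i) (v b) (x \<bullet> b))"
proof (induction i arbitrary: x)
  case (Suc i)
  have *: "(nn_conv (\<lambda>x. \<Prod>b\<in>Basis. u b (x \<bullet> b)) ^^ i) (\<lambda>x. \<Prod>b\<in>Basis. v b (x \<bullet> b)) =
      (\<lambda>x. \<Prod>b\<in>Basis. (nn_conv (u b) ^^ i) (v b) (x \<bullet> b))"
    using Suc by auto
  have "(\<integral>\<^sup>+ y. (\<Prod>b\<in>Basis. u b ((x - y) \<bullet> b)) * (\<Prod>b\<in>Basis. (nn_conv (u b) ^^ i) (v b) (y \<bullet> b)) \<partial>lborel) =
      (\<integral>\<^sup>+ y. (\<Prod>b\<in>Basis. u b (x \<bullet> b - y \<bullet> b) * (nn_conv (u b) ^^ i) (v b) (y \<bullet> b)) \<partial>lborel)"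
    by (simp add: prod.distrib inner_diff_left)
  also have "\<dots> = (\<Prod>b\<in>Basis. \<integral>\<^sup>+ y. u b (x \<bullet> b - y) * (nn_conv (u b) ^^ i) (v b) y \<partial>lborel)"
    by (rule nn_integral_lborel_prod) auto
  finally show ?case
    by (simp only: funpow.simps o_def *) (simp add: nn_conv_def)
qed simp

lemma prod_le_power_card_ennreal:
  fixes f :: "'b \<Rightarrow> ennreal"
  assumes "finite A" "\<And>b. b \<in> A \<Longrightarrow> f b \<le> c"
  shows "(\<Prod>b\<in>A. f b) \<le> c ^ card A"
  using assms by (induction A rule: finite_induct) (auto intro!: mult_mono)

lemma nn_conv_box_power_le:
  fixes x x0 :: "'a::euclidean_space" and h :: real
  assumes h: "0 < h"
  defines "U \<equiv> (\<lambda>x::'a. \<Prod>b\<in>Basis. indicator {x0 \<bullet> b..<x0 \<bullet> b + 2 * h} (x \<bullet> b) :: ennreal)"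
  shows "(nn_conv U ^^ i) U x \<le> ennreal (((2 * h) ^ Suc i / (h * sqrt (real i + 1))) ^ DIM('a))"
proof -
  have "(nn_conv U ^^ i) U x = (\<Prod>b\<in>Basis. (nn_conv (indicator {x0 \<bullet> b..<x0 \<bullet> b + 2 * h}) ^^ i)
      (indicator {x0 \<bullet> b..<x0 \<bullet> b + 2 * h}) (x \<bullet> b))"
    unfolding U_def by (rule nn_conv_power_prod) auto
  also have "\<dots> \<le> ennreal ((2 * h) ^ Suc i / (h * sqrt (real i + 1))) ^ DIM('a)"
    by (intro prod_le_power_card_ennreal nn_conv_interval_power_le h finite_Basis)
  finally show ?thesis using h by (subst ennreal_power[symmetric]) auto
qed

text \<open>
  For \<open>i \<ge> 1\<close> the decay comes from the box alone, since convolving with a probability density does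
  not increase the supremum; for \<open>i = 0\<close> the assumed bound on the density has to be used. The
  constant covers both cases, the factor \<open>2\<^sup>n\<^sup>/\<^sup>2\<close> paying for the shift from \<open>i\<close> to \<open>i + 1\<close>.
\<close>

lemma box_convolution_decay:
  fixes x x0 :: "'a::euclidean_space" and h M :: real and F :: "'a \<Rightarrow> ennreal"
  assumes h: "0 < h" and M: "0 \<le> M"
    and [measurable]: "F \<in> borel_measurable borel"
    and F1: "(\<integral>\<^sup>+ x. F x \<partial>lborel) = 1" and FM: "\<And>x. F x \<le> ennreal M"
  defines "U \<equiv> (\<lambda>x::'a. \<Prod>b\<in>Basis. indicator {x0 \<bullet> b..<x0 \<bullet> b + 2 * h} (x \<bullet> b) :: ennreal)"
    and "n \<equiv> DIM('a)"
  shows "(nn_conv U ^^ i) F x \<le>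
    ennreal ((M + 2 powr (real n / 2) / h ^ n) * ((2 * h) ^ n) ^ i * (real i + 1) powr (- real n / 2))"
proof (cases i)
  case 0
  have "ennreal M \<le> ennreal (M + 2 powr (real n / 2) / h ^ n)" using h by (intro ennreal_leI) simp
  with FM[of x] show ?thesis unfolding 0 by (simp del: ennreal_plus)
next
  case (Suc j)
  have [measurable]: "U \<in> borel_measurable borel" unfolding U_def by measurable
  let ?G = "(nn_conv U ^^ j) U"
  have "(nn_conv U ^^ i) F = nn_conv ?G F"
    by (simp add: Suc nn_conv_power_assoc funpow_swap1)
  also have "\<dots> = nn_conv F ?G" by (rule nn_conv_commute) auto
  finally have "(nn_conv U ^^ i) F x = nn_conv F ?G x" by simp
  also have "\<dots> \<le> ennreal (((2 * h) ^ Suc j / (h * sqrt (real j + 1))) ^ n) * (\<integral>\<^sup>+ x. F x \<partial>lborel)"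
  proof (rule nn_conv_le)
    show "?G x \<le> ennreal (((2 * h) ^ Suc j / (h * sqrt (real j + 1))) ^ n)" for x
      unfolding n_def U_def by (rule nn_conv_box_power_le[OF h])
  qed auto
  also have "\<dots> = ennreal (((2 * h) ^ Suc j / (h * sqrt (real j + 1))) ^ n)"
    by (simp add: F1)
  also have "\<dots> \<le> ennreal ((M + 2 powr (real n / 2) / h ^ n) * ((2 * h) ^ n) ^ i * (real i + 1) powr (- real n / 2))"
  proof (rule ennreal_leI)
    have "1 / sqrt (real j + 1) ^ n = (real j + 1) powr (- real n / 2)"
      by (simp add: powr_half_sqrt[symmetric] powr_power powr_minus inverse_eq_divide)
    also have "\<dots> \<le> ((real i + 1) / 2) powr (- real n / 2)"
      by (rule powr_mono2') (auto simp: Suc)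
    also have "\<dots> = 2 powr (real n / 2) * (real i + 1) powr (- real n / 2)"
      by (simp add: powr_divide powr_minus field_simps)
    finally have s: "1 / sqrt (real j + 1) ^ n \<le> 2 powr (real n / 2) * (real i + 1) powr (- real n / 2)" .
    have "((2 * h) ^ Suc j / (h * sqrt (real j + 1))) ^ n = ((2 * h) ^ n) ^ i / h ^ n * (1 / sqrt (real j + 1) ^ n)"
      by (simp only: Suc power_divide power_mult_distrib power_mult[symmetric] mult.commute[of n]) (simp add: field_simps)
    also have "\<dots> \<le> ((2 * h) ^ n) ^ i / h ^ n * (2 powr (real n / 2) * (real i + 1) powr (- real n / 2))"
      using h by (intro mult_left_mono s) auto
    also have "\<dots> = (2 powr (real n / 2) / h ^ n) * ((2 * h) ^ n) ^ i * (real i + 1) powr (- real n / 2)"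
      by simp
    also have "\<dots> \<le> (M + 2 powr (real n / 2) / h ^ n) * ((2 * h) ^ n) ^ i * (real i + 1) powr (- real n / 2)"
      using h M by (intro mult_right_mono) auto
    finally show "((2 * h) ^ Suc j / (h * sqrt (real j + 1))) ^ n \<le>
      (M + 2 powr (real n / 2) / h ^ n) * ((2 * h) ^ n) ^ i * (real i + 1) powr (- real n / 2)" .
  qed
  finally show ?thesis .
qed

section \<open>A box below the self-convolution of a density\<close>

text \<open>
  The core of the theorem of Steinhaus: a small translate of \<open>K\<close> stays inside an open superset
  whose measure is less than \<open>3/2\<close> times that of \<open>K\<close>, so \<open>K\<close> and its translate must overlap in at
  least half the measure of \<open>K\<close>.
\<close>

lemma compact_inter_translate_measure:
  fixes K :: "'a::euclidean_space set"
  assumes K: "compact K" and pos: "0 < emeasure lborel K"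
  shows "\<exists>r>0. \<exists>c>0. \<forall>s. norm s < r \<longrightarrow> ennreal c \<le> emeasure lborel (K \<inter> (\<lambda>x. x + s) ` K)"
proof -
  have [measurable]: "K \<in> sets borel" using K by (simp add: borel_compact)
  have fin: "emeasure lborel K < \<infinity>" using K by (rule emeasure_compact_finite)
  define c where "c = measure lborel K / 2"
  have mK: "emeasure lborel K = ennreal (2 * c)"
    using fin by (simp add: c_def emeasure_eq_ennreal_measure)
  have c: "0 < c" using pos fin by (simp add: mK)
  obtain V where V: "open V" "K \<subseteq> V" "emeasure lborel (V - K) < ennreal c"
    using outer_regular_lborel[of K c] c by auto
  obtain r where r: "r > 0" "(\<Union>x\<in>K. ball x r) \<subseteq> V"
    using compact_subset_open_imp_ball_epsilon_subset[OF K V(1,2)] by blast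
  show ?thesis
  proof (intro exI conjI allI impI)
    fix s :: 'a assume s: "norm s < r"
    let ?T = "(\<lambda>x. x + s) ` K"
    have T: "compact ?T" using K by (intro compact_continuous_image continuous_intros)
    then have [measurable]: "?T \<in> sets borel" by (simp add: borel_compact)
    have "?T \<subseteq> V"
    proof
      fix y assume "y \<in> ?T"
      then obtain x where "x \<in> K" "y = x + s" by auto
      then have "y \<in> ball x r" using s by (simp add: dist_norm)
      then show "y \<in> V" using r \<open>x \<in> K\<close> by blast
    qed
    then have "emeasure lborel (?T - K) \<le> emeasure lborel (V - K)"
      using V by (intro emeasure_mono) auto
    then have 1: "emeasure lborel (?T - K) \<le> ennreal c" using V(3) by simp
    have "emeasure lborel ?T = emeasure lborel K"
      using emeasure_lebesgue_affine[of 1 s K] by (simp add: add.commute)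
    then have "ennreal (2 * c) = emeasure lborel ((?T - K) \<union> (K \<inter> ?T))"
      unfolding mK by (metis Un_Diff_Int inf_commute)
    also have "\<dots> = emeasure lborel (?T - K) + emeasure lborel (K \<inter> ?T)"
      by (rule plus_emeasure[symmetric]) auto
    also have "\<dots> \<le> ennreal c + emeasure lborel (K \<inter> ?T)"
      using 1 by (rule add_right_mono)
    finally have "ennreal c + ennreal c \<le> ennreal c + emeasure lborel (K \<inter> ?T)"
      using c by (simp add: ennreal_plus[symmetric] del: ennreal_plus)
    then show "ennreal c \<le> emeasure lborel (K \<inter> ?T)"
      by (simp add: ennreal_add_left_cancel_le)
  qed (use c r in auto)
qed

lemma ex_compact_subset_pos_measure:
  fixes B :: "'a::euclidean_space set"
  assumes [measurable]: "B \<in> sets borel" and B: "emeasure lborel B \<noteq> 0"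
  obtains K where "compact K" "K \<subseteq> B" "0 < emeasure lborel K"
proof -
  obtain m where m: "emeasure lborel (B \<inter> cball 0 (real m)) \<noteq> 0"
  proof (rule ccontr)
    assume "\<not> thesis"
    with that have "\<And>m. emeasure lborel (B \<inter> cball 0 (real m)) = 0" by blast
    then have "emeasure lborel (\<Union>m. B \<inter> cball 0 (real m)) = 0"
      by (intro emeasure_UN_eq_0) auto
    moreover have "(\<Union>m. B \<inter> cball 0 (real m)) = B"
    proof (intro equalityI subsetI)
      fix x assume "x \<in> B"
      moreover obtain m where "norm x \<le> real m" using real_arch_simple by blast
      ultimately show "x \<in> (\<Union>m. B \<inter> cball 0 (real m))" by auto
    qed auto
    ultimately show False using B by simp
  qed
  define D where "D = B \<inter> cball 0 (real m)"
  have [measurable]: "D \<in> sets borel" by (simp add: D_def)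
  have "emeasure lborel D \<le> emeasure lborel (cball 0 (real m) :: 'a set)"
    unfolding D_def by (intro emeasure_mono) auto
  also have "\<dots> < \<infinity>" by (intro emeasure_compact_finite compact_cball)
  finally have fin: "emeasure lborel D < \<infinity>" .
  define e where "e = measure lborel D"
  have e1: "emeasure lborel D = ennreal e"
    using fin by (simp add: e_def emeasure_eq_ennreal_measure)
  moreover have "e \<noteq> 0" using m e1 by (auto simp: D_def)
  moreover have "0 \<le> e" by (simp add: e_def)
  ultimately have e: "emeasure lborel D = ennreal e" "0 < e" by auto
  obtain K where K: "closed K" "K \<subseteq> D" "emeasure lebesgue (D - K) < ennreal e"
    by (rule sets_lebesgue_inner_closed[OF sets_completionI_sets[OF \<open>D \<in> sets borel\<close>[folded sets_lborel]] e(2)])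
  have [measurable]: "K \<in> sets borel" using K by simp
  show thesis
  proof
    show "compact K"
      unfolding compact_eq_bounded_closed
      using K(1,2) bounded_subset[OF bounded_cball, of K 0 "real m"] by (simp add: D_def)
    show "K \<subseteq> B" using K by (auto simp: D_def)
    show "0 < emeasure lborel K"
    proof (rule ccontr)
      assume "\<not> 0 < emeasure lborel K"
      then have "K \<in> null_sets lborel" by (auto simp: null_sets_def)
      then have "emeasure lborel (D - K) = emeasure lborel D"
        by (rule emeasure_Diff_null_set) auto
      then show False using K(3) e by simp
    qed
  qed
qed

text \<open>
  Some superlevel set \<open>A\<close> of \<open>f\<close> has positive measure, and then so has \<open>A \<inter> (x0 - A)\<close> for some
  \<open>x0\<close>. This intersection is symmetric about \<open>x0/2\<close>, which turns a sum of two of its points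
  into a difference, so that the overlap of a compact subset with its small translates bounds
  the convolution below.
\<close>

lemma nn_conv_self_ge_on_ball:
  fixes f :: "'a::euclidean_space \<Rightarrow> ennreal"
  assumes [measurable]: "f \<in> borel_measurable borel" and pos: "(\<integral>\<^sup>+ x. f x \<partial>lborel) \<noteq> 0"
  shows "\<exists>x0. \<exists>r>0. \<exists>c>0. \<forall>x. norm (x - x0) < r \<longrightarrow> ennreal c \<le> nn_conv f f x"
proof -
  obtain n where n: "emeasure lborel {x. 1 / real (Suc n) \<le> f x} \<noteq> 0"
  proof (rule ccontr)
    assume "\<not> thesis"
    with that have 0: "\<And>n. emeasure lborel {x. 1 / real (Suc n) \<le> f x} = 0" by blast
    have "AE x in lborel. \<forall>n. f x < ennreal (1 / real (Suc n))"
      unfolding AE_all_countable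
    proof
      fix n
      show "AE x in lborel. f x < ennreal (1 / real (Suc n))"
        by (rule AE_I[where N="{x. 1 / real (Suc n) \<le> f x}"]) (use 0[of n] in \<open>auto simp: not_less\<close>)
    qed
    then have "AE x in lborel. f x = 0"
    proof eventually_elim
      case (elim x)
      show "f x = 0"
      proof (rule ccontr)
        assume "f x \<noteq> 0"
        moreover have "f x < ennreal 1" using elim[rule_format, of 0] by simp
        ultimately obtain y where y: "f x = ennreal y" "0 < y"
          by (cases "f x") (auto simp: top_unique)
        obtain n where "1 / real (Suc n) < y" using y(2) nat_approx_posE by blast
        then show False using elim[rule_format, of n] y by (simp add: ennreal_less_iff)
      qed
    qed
    then have "(\<integral>\<^sup>+ x. f x \<partial>lborel) = 0" by (simp add: nn_integral_0_iff_AE)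
    with pos show False by simp
  qed
  define d where "d = 1 / real (Suc n)"
  have d: "0 < d" by (simp add: d_def)
  define A where "A = {x. ennreal d \<le> f x}"
  have [measurable]: "A \<in> sets borel" unfolding A_def by measurable
  have A: "emeasure lborel A \<noteq> 0" using n by (simp add: A_def d_def)
  have "(\<integral>\<^sup>+ x. nn_conv (indicator A) (indicator A) x \<partial>lborel) \<noteq> 0"
    using A by (simp add: nn_integral_nn_conv)
  then have "\<exists>x0. nn_conv (indicator A) (indicator A) x0 \<noteq> 0"
    by (rule contrapos_np) simp
  then obtain x0 where "nn_conv (indicator A) (indicator A) x0 \<noteq> 0" by blast
  moreover define B where "B = {y. y \<in> A \<and> x0 - y \<in> A}"
  moreover have [measurable]: "B \<in> sets borel" unfolding B_def by measurable
  moreover have "indicator A (x0 - y) * indicator A y = (indicator B y :: ennreal)" for y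
    by (auto simp: B_def indicator_def)
  ultimately have B: "emeasure lborel B \<noteq> 0"
    by (simp add: nn_conv_def)
  obtain K where K: "compact K" "K \<subseteq> B" "0 < emeasure lborel K"
    by (rule ex_compact_subset_pos_measure[OF \<open>B \<in> sets borel\<close> B])
  obtain r c where rc: "0 < r" "0 < c" "\<And>s. norm s < r \<Longrightarrow> ennreal c \<le> emeasure lborel (K \<inter> (\<lambda>x. x + s) ` K)"
    using compact_inter_translate_measure[OF K(1,3)] by auto
  show ?thesis
  proof (intro exI conjI allI impI)
    fix x assume x: "norm (x - x0) < r"
    let ?S = "K \<inter> (\<lambda>y. y + (x - x0)) ` K"
    have "compact ((\<lambda>y. y + (x - x0)) ` K)" using K by (intro compact_continuous_image continuous_intros)
    then have [measurable]: "?S \<in> sets borel" using K(1) by (intro sets.Int borel_compact)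
    have "ennreal (d * d * c) \<le> ennreal (d * d) * emeasure lborel ?S"
      using rc(3)[OF x] d rc(2) by (simp add: ennreal_mult mult_left_mono)
    also have "\<dots> = (\<integral>\<^sup>+ y. ennreal (d * d) * indicator ?S y \<partial>lborel)"
      by (simp add: nn_integral_cmult_indicator)
    also have "\<dots> \<le> (\<integral>\<^sup>+ y. f (x - y) * f y \<partial>lborel)"
    proof (rule nn_integral_mono)
      fix y
      show "ennreal (d * d) * indicator ?S y \<le> f (x - y) * f y"
      proof (cases "y \<in> ?S")
        case True
        then obtain z where z: "z \<in> K" "y = z + (x - x0)" by auto
        have "y \<in> B" "z \<in> B" using True z(1) K(2) by blast+
        moreover have "x - y = x0 - z" using z(2) by simp
        ultimately have "y \<in> A" "x - y \<in> A" by (auto simp: B_def)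
        then have "ennreal d * ennreal d \<le> f (x - y) * f y"
          by (intro mult_mono) (auto simp: A_def)
        then show ?thesis using True d by (simp add: ennreal_mult)
      qed simp
    qed
    finally show "ennreal (d * d * c) \<le> nn_conv f f x" by (simp add: nn_conv_def)
  qed (use rc d in auto)
qed

lemma nn_conv_ge_box:
  fixes f :: "'a::euclidean_space \<Rightarrow> ennreal"
  assumes [measurable]: "f \<in> borel_measurable borel" and pos: "(\<integral>\<^sup>+ x. f x \<partial>lborel) \<noteq> 0"
  shows "\<exists>x0. \<exists>h>0. \<exists>c>0. \<forall>x. ennreal c * (\<Prod>b\<in>Basis. indicator {x0 \<bullet> b..<x0 \<bullet> b + 2 * h} (x \<bullet> b)) \<le> nn_conv f f x"
proof -
  obtain x0 r c where rc: "0 < r" "0 < c" "\<And>x. norm (x - x0) < r \<Longrightarrow> ennreal c \<le> nn_conv f f x"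
    using nn_conv_self_ge_on_ball[OF assms] by auto
  \<comment> \<open>The \<open>l\<^sup>1\<close> norm dominates the Euclidean one, so a box of side \<open>2 h\<close> fits into the ball.\<close>
  define h where "h = r / (4 * DIM('a))"
  have h: "0 < h" using rc by (simp add: h_def)
  have "ennreal c * (\<Prod>b\<in>Basis. indicator {x0 \<bullet> b..<x0 \<bullet> b + 2 * h} (x \<bullet> b)) \<le> nn_conv f f x" for x
  proof (cases "\<forall>b\<in>Basis. x \<bullet> b \<in> {x0 \<bullet> b..<x0 \<bullet> b + 2 * h}")
    case True
    have "norm (x - x0) \<le> (\<Sum>b\<in>Basis. \<bar>(x - x0) \<bullet> b\<bar>)" by (rule norm_le_l1)
    also have "\<dots> \<le> (\<Sum>b\<in>(Basis :: 'a set). 2 * h)"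
      by (rule sum_mono) (use True in \<open>force simp: inner_diff_left\<close>)
    also have "\<dots> < r" using rc by (simp add: h_def)
    finally show ?thesis using True rc(3)[of x] by simp
  next
    case False
    then obtain b where "b \<in> Basis" "x \<bullet> b \<notin> {x0 \<bullet> b..<x0 \<bullet> b + 2 * h}" by blast
    then have "(\<Prod>b\<in>Basis. indicator {x0 \<bullet> b..<x0 \<bullet> b + 2 * h} (x \<bullet> b)) = (0::ennreal)"
      by (intro prod_zero) (auto intro!: bexI[of _ b])
    then show ?thesis by (simp only: mult_zero_right zero_le)
  qed
  with h rc(2) show ?thesis by blast
qed

section \<open>Boundedness of convolution powers of a p-integrable function\<close>

text \<open>
  The iterated convolution as a single integral over a product measure, in which the \<open>k + 1\<close>
  factors can be treated symmetrically.
\<close>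

lemma nn_conv_power_eq_PiM:
  fixes f g :: "'a::euclidean_space \<Rightarrow> ennreal"
  assumes [measurable]: "f \<in> borel_measurable borel" "g \<in> borel_measurable borel"
  shows "(nn_conv f ^^ k) g x =
    (\<integral>\<^sup>+ \<omega>. (\<Prod>i<k. f (\<omega> i)) * g (x - (\<Sum>i<k. \<omega> i)) \<partial>(\<Pi>\<^sub>M i\<in>{..<k}. lborel))"
proof (induction k arbitrary: x)
  interpret product_sigma_finite "\<lambda>i::nat. lborel :: 'a measure" ..
  case 0
  then show ?case by (simp add: PiM_empty nn_integral_count_space_finite)
next
  interpret product_sigma_finite "\<lambda>i::nat. lborel :: 'a measure" ..
  case (Suc k)
  have "(nn_conv f ^^ Suc k) g x = (\<integral>\<^sup>+ y. (nn_conv f ^^ k) g (x - y) * f y \<partial>lborel)"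
    using nn_conv_commute[of f "(nn_conv f ^^ k) g"] by (simp add: nn_conv_def)
  also have "\<dots> = (\<integral>\<^sup>+ y. \<integral>\<^sup>+ \<omega>. (\<Prod>i<k. f (\<omega> i)) * g (x - y - (\<Sum>i<k. \<omega> i)) * f y
      \<partial>(\<Pi>\<^sub>M i\<in>{..<k}. lborel) \<partial>lborel)"
    unfolding Suc by (subst nn_integral_multc) auto
  also have "\<dots> = (\<integral>\<^sup>+ y. \<integral>\<^sup>+ \<omega>. (\<Prod>i<Suc k. f ((fun_upd \<omega> k y) i)) * g (x - (\<Sum>i<Suc k. (fun_upd \<omega> k y) i))
      \<partial>(\<Pi>\<^sub>M i\<in>{..<k}. lborel) \<partial>lborel)"
    by (intro nn_integral_cong) (simp add: diff_diff_eq add.commute mult_ac cong: prod.cong_simp sum.cong_simp)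
  also have "\<dots> = (\<integral>\<^sup>+ \<omega>. (\<Prod>i<Suc k. f (\<omega> i)) * g (x - (\<Sum>i<Suc k. \<omega> i)) \<partial>(\<Pi>\<^sub>M i\<in>insert k {..<k}. lborel))"
    by (rule product_nn_integral_insert_rev[symmetric]) (auto simp: lessThan_Suc)
  finally show ?case by (simp only: lessThan_Suc)
qed

text \<open>
  The least factor is at most the product of the \<open>1/k\<close>-th powers of the others. The index of the
  least factor is not known, whence the sum. This elementary step takes the place of the
  generalized Hoelder inequality.
\<close>

lemma prod_le_sum_prod_powr:
  fixes a :: "nat \<Rightarrow> real"
  assumes nonneg: "\<And>i. i \<le> k \<Longrightarrow> 0 \<le> a i" and k: "0 < k"
  shows "(\<Prod>i\<le>k. a i) \<le> (\<Sum>j\<le>k. \<Prod>i\<in>{..k}-{j}. a i powr (1 + 1 / real k))"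
proof -
  obtain j where j: "j \<le> k" "\<And>i. i \<le> k \<Longrightarrow> a j \<le> a i"
    using ex_min_if_finite[of "a ` {..k}"]
    by (metis (no_types, lifting) atMost_iff finite_atMost finite_imageI imageE imageI image_is_empty linorder_not_less not_empty_eq_Iic_eq_empty)
  have "(\<Prod>i\<le>k. a i) = a j * (\<Prod>i\<in>{..k}-{j}. a i)"
    using j by (intro prod.remove) auto
  also have "a j = (\<Prod>i\<in>{..k}-{j}. a j powr (1 / real k))"
    using j k nonneg[of j] by (cases "a j = 0") (simp_all add: powr_power)
  also have "\<dots> * (\<Prod>i\<in>{..k}-{j}. a i) = (\<Prod>i\<in>{..k}-{j}. a j powr (1 / real k) * a i)"
    by (simp add: prod.distrib)
  also have "\<dots> \<le> (\<Prod>i\<in>{..k}-{j}. a i powr (1 + 1 / real k))"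
  proof (intro prod_mono conjI)
    fix i assume i: "i \<in> {..k}-{j}"
    show "0 \<le> a j powr (1 / real k) * a i" using nonneg[of i] i by auto
    have "a j powr (1 / real k) * a i \<le> a i powr (1 / real k) * a i"
      using i nonneg[of i] nonneg[of j] j by (intro mult_right_mono powr_mono2) auto
    also have "\<dots> = a i powr (1 + 1 / real k)"
      using nonneg[of i] i by (simp add: powr_add)
    finally show "a j powr (1 / real k) * a i \<le> a i powr (1 + 1 / real k)" .
  qed
  also have "\<dots> \<le> (\<Sum>j\<le>k. \<Prod>i\<in>{..k}-{j}. a i powr (1 + 1 / real k))"
    using j(1) by (intro member_le_sum) (auto intro!: prod_nonneg)
  finally show ?thesis .
qed

text \<open>
  The extreme case of Young's inequality, with target \<open>L\<^sup>\<infinity>\<close>. After one factor has been dropped, the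
  remaining \<open>k\<close> factors depend on independent variables and the integral splits. If the dropped
  factor is one of the \<open>k\<close> integration variables, integrating over that variable first frees the
  last factor from the others.
\<close>

lemma nn_conv_power_bounded:
  fixes \<phi> :: "'a::euclidean_space \<Rightarrow> real"
  assumes [measurable]: "\<phi> \<in> borel_measurable borel" and nonneg: "\<And>x. 0 \<le> \<phi> x" and k: "0 < k"
  defines "H \<equiv> \<integral>\<^sup>+ x. ennreal (\<phi> x powr (1 + 1 / real k)) \<partial>lborel"
  shows "(nn_conv (\<lambda>x. ennreal (\<phi> x)) ^^ k) (\<lambda>x. ennreal (\<phi> x)) x \<le> of_nat (Suc k) * H ^ k"
proof -
  interpret product_sigma_finite "\<lambda>i::nat. lborel :: 'a measure" ..
  define h where "h x = ennreal (\<phi> x powr (1 + 1 / real k))" for x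
  have [measurable]: "h \<in> borel_measurable borel" by (simp add: h_def[abs_def])
  have H: "H = integral\<^sup>N lborel h" by (simp add: H_def h_def[abs_def])
  have pointwise: "(\<Prod>i<k. ennreal (\<phi> (\<omega> i))) * ennreal (\<phi> z) \<le>
      (\<Prod>i<k. h (\<omega> i)) + (\<Sum>j<k. (\<Prod>i\<in>{..<k}-{j}. h (\<omega> i)) * h z)" for \<omega> z
  proof -
    define a where "a i = \<phi> (if i = k then z else \<omega> i)" for i
    have eq: "{..k} = insert k {..<k}" by auto
    have ne: "{..k} - {j} = insert k ({..<k} - {j})" "k \<notin> {..<k} - {j}" if "j < k" for j using that by auto
    have ek: "{..k} - {k} = {..<k}" by auto
    have ai: "a i = \<phi> (\<omega> i)" if "i < k" for i using that by (simp add: a_def)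
    have ak: "a k = \<phi> z" by (simp add: a_def)
    have "(\<Prod>i<k. ennreal (\<phi> (\<omega> i))) * ennreal (\<phi> z) = ennreal (\<Prod>i\<le>k. a i)"
      unfolding eq by (simp add: ak ai prod_nonneg nonneg prod_ennreal ennreal_mult mult.commute)
    also have "\<dots> \<le> ennreal (\<Sum>j\<le>k. \<Prod>i\<in>{..k}-{j}. a i powr (1 + 1 / real k))"
      by (intro ennreal_leI prod_le_sum_prod_powr k) (auto simp: a_def nonneg)
    also have "\<dots> = (\<Sum>j\<le>k. \<Prod>i\<in>{..k}-{j}. ennreal (a i powr (1 + 1 / real k)))"
      by (simp add: prod_ennreal prod_nonneg sum_ennreal)
    also have "\<dots> = (\<Prod>i<k. h (\<omega> i)) + (\<Sum>j<k. (\<Prod>i\<in>{..<k}-{j}. h (\<omega> i)) * h z)"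
      unfolding eq by (subst sum.insert) (auto simp: eq[symmetric] ek ne ak h_def ai mult.commute intro!: sum.cong)
    finally show ?thesis .
  qed
  have int_j: "(\<integral>\<^sup>+ \<omega>. (\<Prod>i\<in>{..<k}-{j}. h (\<omega> i)) * h (x - (\<Sum>i<k. \<omega> i)) \<partial>(\<Pi>\<^sub>M i\<in>{..<k}. lborel)) = H ^ k"
    if j: "j < k" for j
  proof -
    let ?I = "{..<k}-{j}"
    have I: "{..<k} = insert j ?I" "j \<notin> ?I" "finite ?I" using j by auto
    have "(\<integral>\<^sup>+ \<omega>. (\<Prod>i\<in>?I. h (\<omega> i)) * h (x - (\<Sum>i\<in>insert j ?I. \<omega> i)) \<partial>(\<Pi>\<^sub>M i\<in>insert j ?I. lborel)) =
      (\<integral>\<^sup>+ \<omega>. \<integral>\<^sup>+ y. (\<Prod>i\<in>?I. h ((fun_upd \<omega> j y) i)) * h (x - (\<Sum>i\<in>insert j ?I. (fun_upd \<omega> j y) i)) \<partial>lborel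
        \<partial>(\<Pi>\<^sub>M i\<in>?I. lborel))"
      using I(2,3) by (intro product_nn_integral_insert) measurable
    also have "\<dots> = (\<integral>\<^sup>+ \<omega>. \<integral>\<^sup>+ y. (\<Prod>i\<in>?I. h (\<omega> i)) * h ((x - (\<Sum>i\<in>?I. \<omega> i)) - y) \<partial>lborel
        \<partial>(\<Pi>\<^sub>M i\<in>?I. lborel))"
    proof (intro nn_integral_cong)
      fix \<omega> y
      have "(\<Prod>i\<in>?I. h ((fun_upd \<omega> j y) i)) = (\<Prod>i\<in>?I. h (\<omega> i))" "(\<Sum>i\<in>?I. (fun_upd \<omega> j y) i) = (\<Sum>i\<in>?I. \<omega> i)"
        by (auto intro!: prod.cong sum.cong)
      then show "(\<Prod>i\<in>?I. h ((fun_upd \<omega> j y) i)) * h (x - (\<Sum>i\<in>insert j ?I. (fun_upd \<omega> j y) i)) =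
          (\<Prod>i\<in>?I. h (\<omega> i)) * h ((x - (\<Sum>i\<in>?I. \<omega> i)) - y)"
        by (subst sum.insert) (auto simp: diff_diff_eq add.commute)
    qed
    also have "\<dots> = (\<integral>\<^sup>+ \<omega>. (\<Prod>i\<in>?I. h (\<omega> i)) * H \<partial>(\<Pi>\<^sub>M i\<in>?I. lborel))"
      by (simp add: nn_integral_cmult nn_integral_reflect H)
    also have "\<dots> = (\<integral>\<^sup>+ \<omega>. (\<Prod>i\<in>?I. h (\<omega> i)) \<partial>(\<Pi>\<^sub>M i\<in>?I. lborel)) * H"
      by (rule nn_integral_multc) measurable
    also have "(\<integral>\<^sup>+ \<omega>. (\<Prod>i\<in>?I. h (\<omega> i)) \<partial>(\<Pi>\<^sub>M i\<in>?I. lborel)) = H ^ (k - 1)"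
      using j by (subst product_nn_integral_prod) (auto simp: H)
    also have "H ^ (k - 1) * H = H ^ k" using k by (cases k) (auto simp: mult.commute)
    finally show ?thesis using I(1) by simp
  qed
  have "(nn_conv (\<lambda>x. ennreal (\<phi> x)) ^^ k) (\<lambda>x. ennreal (\<phi> x)) x \<le>
    (\<integral>\<^sup>+ \<omega>. (\<Prod>i<k. h (\<omega> i)) + (\<Sum>j<k. (\<Prod>i\<in>{..<k}-{j}. h (\<omega> i)) * h (x - (\<Sum>i<k. \<omega> i)))
      \<partial>(\<Pi>\<^sub>M i\<in>{..<k}. lborel))"
    by (subst nn_conv_power_eq_PiM) (auto intro!: nn_integral_mono pointwise)
  also have "\<dots> = (\<integral>\<^sup>+ \<omega>. (\<Prod>i<k. h (\<omega> i)) \<partial>(\<Pi>\<^sub>M i\<in>{..<k}. lborel)) +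
      (\<Sum>j<k. \<integral>\<^sup>+ \<omega>. (\<Prod>i\<in>{..<k}-{j}. h (\<omega> i)) * h (x - (\<Sum>i<k. \<omega> i)) \<partial>(\<Pi>\<^sub>M i\<in>{..<k}. lborel))"
    by (subst nn_integral_add, measurable, subst nn_integral_sum) (auto, measurable)
  also have "\<dots> = H ^ k + (\<Sum>j<k. H ^ k)"
    by (intro arg_cong2[where f="(+)"] sum.cong refl)
      (simp add: H product_nn_integral_prod[of "{..<k}" "\<lambda>_. h"], simp add: int_j)
  also have "\<dots> = of_nat (Suc k) * H ^ k"
    by (simp add: distrib_right)
  finally show ?thesis .
qed

text \<open>
  A Borel version of \<open>|J|\<close> for which the bound on the \<open>N\<close>-fold convolution holds at every point.
  For \<open>\<epsilon>0 = \<infinity>\<close>, where \<open>N = 1\<close>, this requires truncating the version at the essential supremum.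
\<close>

lemma ex_majorant_bounded_power:
  fixes J :: "'a::euclidean_space \<Rightarrow> complex" and \<epsilon>0 :: ennreal
  assumes J: "integrable lebesgue J" and \<epsilon>0: "0 < \<epsilon>0" and Lp: "in_Lp (1 + \<epsilon>0) J"
  shows "\<exists>\<phi>\<in>borel_measurable borel. (AE x in lebesgue. ennreal (norm (J x)) = \<phi> x) \<and>
    (\<exists>M\<ge>0. \<forall>x. (nn_conv \<phi> ^^ nat \<lceil>enn2real (1 / \<epsilon>0)\<rceil>) \<phi> x \<le> ennreal M)"
proof -
  obtain K where [measurable]: "K \<in> borel_measurable borel" and K: "AE x in lebesgue. J x = K x"
    using ex_borel_complex[of J] J by auto
  show ?thesis
  proof (cases "\<epsilon>0 = \<infinity>")
    case True
    then have fin: "esssup lebesgue (\<lambda>x. ennreal (norm (J x))) < \<infinity>"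
      using Lp by (simp add: in_Lp_def)
    define M where "M = enn2real (esssup lebesgue (\<lambda>x. ennreal (norm (J x))))"
    have M: "esssup lebesgue (\<lambda>x. ennreal (norm (J x))) = ennreal M"
      using fin by (simp add: M_def less_top)
    have "AE x in lebesgue. ennreal (norm (J x)) \<le> ennreal M"
      unfolding M[symmetric] by (rule esssup_AE)
    with K have "AE x in lebesgue. ennreal (norm (J x)) = min (ennreal (norm (K x))) (ennreal M)"
      by eventually_elim auto
    then show ?thesis using True
      by (intro bexI[of _ "\<lambda>x. min (ennreal (norm (K x))) (ennreal M)"] conjI exI[of _ M])
        (auto simp: M_def)
  next
    case False
    then obtain e where e: "\<epsilon>0 = ennreal e" "0 < e"
      using \<epsilon>0 by (cases \<epsilon>0) auto
    define k where "k = nat \<lceil>enn2real (1 / \<epsilon>0)\<rceil>"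
    have "enn2real (1 / \<epsilon>0) = 1 / e"
      using e by (simp add: divide_ennreal flip: ennreal_1)
    then have "1 / e \<le> real k" using e by (simp add: k_def of_nat_ceiling)
    then have k: "0 < k" "1 / real k \<le> e" using e
      by (cases "k = 0"; simp add: field_simps)+
    let ?p = "1 + 1 / real k"
    have "1 + \<epsilon>0 = ennreal (1 + e)" using e by (simp add: ennreal_plus)
    then have pow: "integrable lebesgue (\<lambda>x. norm (J x) powr (1 + e))"
      using Lp e unfolding in_Lp_def by (simp del: ennreal_plus)
    have "integrable lebesgue (\<lambda>x. norm (J x) + norm (J x) powr (1 + e))"
      using J pow by auto
    then have "(\<integral>\<^sup>+ x. ennreal (norm (norm (J x) + norm (J x) powr (1 + e))) \<partial>lebesgue) < \<infinity>"
      by (simp only: integrable_iff_bounded)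
    moreover have "(\<integral>\<^sup>+ x. ennreal (norm (K x) powr ?p) \<partial>lebesgue) \<le>
        (\<integral>\<^sup>+ x. ennreal (norm (norm (J x) + norm (J x) powr (1 + e))) \<partial>lebesgue)"
    proof (rule nn_integral_mono_AE, use K in eventually_elim)
      case (elim x)
      have "norm (K x) powr ?p \<le> norm (K x) + norm (K x) powr (1 + e)"
      proof (cases "norm (K x) \<le> 1")
        case True
        then have "norm (K x) powr ?p \<le> norm (K x) powr 1"
          by (cases "K x = 0") (auto intro!: powr_mono' simp: powr_le_one_le)
        then show ?thesis by (rule order_trans) simp
      next
        case False
        then have "norm (K x) powr ?p \<le> norm (K x) powr (1 + e)"
          using k by (intro powr_mono) auto
        then show ?thesis by (rule order_trans) simp
      qed
      then show ?case using elim by (intro ennreal_leI) simp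
    qed
    ultimately have "(\<integral>\<^sup>+ x. ennreal (norm (K x) powr ?p) \<partial>lebesgue) < \<infinity>"
      by (rule le_less_trans[rotated])
    then have H: "(\<integral>\<^sup>+ x. ennreal (norm (K x) powr ?p) \<partial>lborel) < \<infinity>"
      by (simp add: nn_integral_completion)
    define B where "B = of_nat (Suc k) * (\<integral>\<^sup>+ x. ennreal (norm (K x) powr ?p) \<partial>lborel) ^ k"
    have "B < \<infinity>" using H by (simp add: B_def ennreal_mult_less_top power_less_top_ennreal of_nat_less_top)
    then have B: "B = ennreal (enn2real B)" by (simp add: less_top)
    have "(nn_conv (\<lambda>x. ennreal (norm (K x))) ^^ k) (\<lambda>x. ennreal (norm (K x))) x \<le> B" for x
      unfolding B_def by (rule nn_conv_power_bounded) (use k in auto)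
    moreover have "AE x in lebesgue. ennreal (norm (J x)) = ennreal (norm (K x))"
      using K by eventually_elim simp
    ultimately show ?thesis unfolding k_def[symmetric] using B
      by (intro bexI[of _ "\<lambda>x. ennreal (norm (K x))"] conjI exI[of _ "enn2real B"]) auto
  qed
qed

section \<open>Binomial and Poisson averages of inverse powers\<close>

lemma fact_add_le: "fact (b + n) \<le> (fact n * (real b + 1) ^ n * fact b :: real)"
proof (induction n)
  case (Suc n)
  have "fact (b + Suc n) = (real b + real n + 1) * fact (b + n)"
    by (simp add: algebra_simps)
  also have "\<dots> \<le> (real (Suc n) * (real b + 1)) * (fact n * (real b + 1) ^ n * fact b)"
    using Suc by (intro mult_mono) (auto simp: algebra_simps)
  finally show ?case by (simp add: mult_ac)
qed simp

lemma power_le_fact_add: "(real b + 1) ^ n * fact b \<le> (fact (b + n) :: real)"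
proof (induction n)
  case (Suc n)
  have "(real b + 1) ^ Suc n * fact b = (real b + 1) * ((real b + 1) ^ n * fact b)"
    by simp
  also have "\<dots> \<le> (real b + real n + 1) * fact (b + n)"
    using Suc by (intro mult_mono) auto
  also have "\<dots> = fact (b + Suc n)" by (simp add: algebra_simps)
  finally show ?case .
qed simp

text \<open>
  The factor \<open>n! b!/(b+n)!\<close> bounds the integral power \<open>(b+1)\<^sup>-\<^sup>n\<close> and has binomial and Poisson
  averages that can be summed exactly. The arithmetic-geometric mean inequality reduces the
  half-integral power to it; when \<open>l\<close> is the \<open>n/2\<close>-th power of the scale of \<open>b\<close>, both summands have
  the right order.
\<close>

lemma powr_half_le_mean:
  assumes l: "0 < l"
  shows "(real b + 1) powr (- real n / 2) \<le> (l * (fact n * fact b / fact (b + n)) + 1 / l) / 2"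
proof -
  define z where "z = (real b + 1) powr (- real n / 2)"
  have "z\<^sup>2 = (real b + 1) powr (- real n)"
    by (simp add: z_def power2_eq_square flip: powr_add)
  also have "\<dots> = 1 / (real b + 1) ^ n"
    by (simp add: powr_minus powr_realpow inverse_eq_divide)
  also have "\<dots> \<le> fact n * fact b / fact (b + n)"
    using fact_add_le[of b n] by (simp add: field_simps)
  finally have z2: "z\<^sup>2 \<le> fact n * fact b / fact (b + n)" .
  have "0 \<le> (l * z - 1)\<^sup>2 / l" using l by simp
  also have "\<dots> = l * z\<^sup>2 - 2 * z + 1 / l"
    using l by (simp add: power2_eq_square field_simps)
  finally have "z \<le> (l * z\<^sup>2 + 1 / l) / 2" by simp
  also have "\<dots> \<le> (l * (fact n * fact b / fact (b + n)) + 1 / l) / 2"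
    using z2 l by (intro divide_right_mono add_right_mono mult_left_mono) auto
  finally show ?thesis by (simp add: z_def)
qed

lemma binomial_expectation_decay:
  fixes \<delta> \<rho> :: real
  assumes "0 < \<delta>" "0 \<le> \<rho>" "\<delta> + \<rho> = 1"
  shows "(\<Sum>b\<le>m. real (m choose b) * (\<delta> ^ b * \<rho> ^ (m - b)) * (real b + 1) powr (- real n / 2))
    \<le> (fact n / \<delta> ^ n + 1) / 2 * (real m + 1) powr (- real n / 2)"
proof -
  define p where "p b = real (m choose b) * (\<delta> ^ b * \<rho> ^ (m - b))" for b
  define l where "l = (real m + 1) powr (real n / 2)"
  have l: "0 < l" by (simp add: l_def)
  have p0: "0 \<le> p b" for b using assms by (simp add: p_def)
  have p1: "(\<Sum>b\<le>m. p b) = 1"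
    using binomial_ring[of \<delta> \<rho> m] assms(3) by (simp add: p_def mult.assoc)
  have summand: "p b * (fact b / fact (b + n)) =
      fact m / fact (m + n) / \<delta> ^ n * (real (m + n choose (b + n)) * \<delta> ^ (b + n) * \<rho> ^ (m + n - (b + n)))"
    if "b \<le> m" for b
    using that assms(1) by (simp add: p_def binomial_fact power_add field_simps)
  have "(\<Sum>b\<le>m. p b * (fact b / fact (b + n))) =
      fact m / fact (m + n) / \<delta> ^ n * (\<Sum>b\<le>m. real (m + n choose (b + n)) * \<delta> ^ (b + n) * \<rho> ^ (m + n - (b + n)))"
    unfolding sum_distrib_left using summand by (intro sum.cong) auto
  also have "(\<Sum>b\<le>m. real (m + n choose (b + n)) * \<delta> ^ (b + n) * \<rho> ^ (m + n - (b + n))) =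
      (\<Sum>c\<in>(\<lambda>b. b + n) ` {..m}. real (m + n choose c) * \<delta> ^ c * \<rho> ^ (m + n - c))"
    by (subst sum.reindex) auto
  finally have "(\<Sum>b\<le>m. p b * (fact b / fact (b + n))) =
      fact m / fact (m + n) / \<delta> ^ n * (\<Sum>c\<in>(\<lambda>b. b + n) ` {..m}. real (m + n choose c) * \<delta> ^ c * \<rho> ^ (m + n - c))" .
  moreover have "(\<Sum>c\<in>(\<lambda>b. b + n) ` {..m}. real (m + n choose c) * \<delta> ^ c * \<rho> ^ (m + n - c)) \<le> 1"
  proof -
    have "(\<Sum>c\<in>(\<lambda>b. b + n) ` {..m}. real (m + n choose c) * \<delta> ^ c * \<rho> ^ (m + n - c)) \<le>
      (\<Sum>c\<le>m + n. real (m + n choose c) * \<delta> ^ c * \<rho> ^ (m + n - c))"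
      using assms by (intro sum_mono2) auto
    also have "\<dots> = 1"
      using binomial_ring[of \<delta> \<rho> "m + n"] assms(3) by simp
    finally show ?thesis .
  qed
  ultimately have "(\<Sum>b\<le>m. p b * (fact b / fact (b + n))) \<le> fact m / fact (m + n) / \<delta> ^ n * 1"
    using assms(1) by (simp only:) (intro mult_left_mono, auto)
  also have "\<dots> \<le> (1 / (real m + 1) ^ n) / \<delta> ^ n"
    using power_le_fact_add[of m n] assms(1) by (simp add: field_simps)
  finally have mean: "(\<Sum>b\<le>m. p b * (fact b / fact (b + n))) \<le> (1 / (real m + 1) ^ n) / \<delta> ^ n" .
  have "(\<Sum>b\<le>m. p b * (real b + 1) powr (- real n / 2)) \<le>
      (\<Sum>b\<le>m. p b * ((l * (fact n * fact b / fact (b + n)) + 1 / l) / 2))"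
    by (intro sum_mono mult_left_mono powr_half_le_mean l p0)
  also have "\<dots> = (l * fact n * (\<Sum>b\<le>m. p b * (fact b / fact (b + n))) + (\<Sum>b\<le>m. p b) / l) / 2"
    by (simp add: sum_distrib_left sum_divide_distrib sum.distrib[symmetric] field_simps)
  also have "\<dots> \<le> (l * fact n * ((1 / (real m + 1) ^ n) / \<delta> ^ n) + 1 / l) / 2"
    using mean l p1 by (intro divide_right_mono add_mono mult_left_mono) auto
  also have "l * fact n * ((1 / (real m + 1) ^ n) / \<delta> ^ n) = fact n / \<delta> ^ n * (1 / l)"
  proof -
    have "(real m + 1) ^ n = l * l"
      by (simp add: l_def powr_add[symmetric] powr_realpow)
    then show ?thesis using l by (simp add: field_simps)
  qed
  also have "1 / l = (real m + 1) powr (- real n / 2)"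
    by (simp add: l_def powr_minus inverse_eq_divide)
  finally show ?thesis by (simp add: p_def field_simps)
qed

lemma poisson_expectation_decay:
  fixes t :: real
  assumes t: "0 < t"
  shows "(\<Sum>k<m. t ^ k / fact k * (real k + 1) powr (- real n / 2))
    \<le> (fact n + 1) / 2 * exp t * t powr (- real n / 2)"
proof -
  have partial: "(\<Sum>k\<in>A. t ^ k / fact k) \<le> exp t" if "finite A" for A
  proof -
    have eq: "t ^ k /\<^sub>R fact k = t ^ k / fact k" for k
      by (simp add: divide_inverse mult.commute)
    show ?thesis
      using t summable_exp_generic[of t] that unfolding exp_def eq
      by (intro sum_le_suminf) auto
  qed
  define l where "l = t powr (real n / 2)"
  have l: "0 < l" using t by (simp add: l_def)
  have "t ^ n * (\<Sum>k<m. t ^ k / fact (k + n)) = (\<Sum>j\<in>(\<lambda>k. k + n) ` {..<m}. t ^ j / fact j)"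
    by (subst sum.reindex) (auto simp: sum_distrib_left power_add mult.commute)
  also have "\<dots> \<le> exp t" by (rule partial) auto
  finally have shifted: "(\<Sum>k<m. t ^ k / fact (k + n)) \<le> exp t / t ^ n"
    using t by (simp add: field_simps)
  have "(\<Sum>k<m. t ^ k / fact k * (real k + 1) powr (- real n / 2)) \<le>
      (\<Sum>k<m. t ^ k / fact k * ((l * (fact n * fact k / fact (k + n)) + 1 / l) / 2))"
    using t by (intro sum_mono mult_left_mono powr_half_le_mean l) auto
  also have "\<dots> = (\<Sum>k<m. l * fact n / 2 * (t ^ k / fact (k + n)) + 1 / (2 * l) * (t ^ k / fact k))"
    by (intro sum.cong refl) (simp add: field_simps)
  also have "\<dots> = (l * fact n * (\<Sum>k<m. t ^ k / fact (k + n)) + (\<Sum>k<m. t ^ k / fact k) / l) / 2"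
    by (simp only: sum.distrib sum_distrib_left[symmetric]) (simp add: add_divide_distrib)
  also have "\<dots> \<le> (l * fact n * (exp t / t ^ n) + exp t / l) / 2"
    using l partial[of "{..<m}"] by (intro divide_right_mono add_mono mult_left_mono shifted) auto
  also have "l * fact n * (exp t / t ^ n) = fact n * exp t * (1 / l)"
  proof -
    have "t ^ n = l * l"
      using t by (simp add: l_def powr_add[symmetric] powr_realpow)
    then show ?thesis using l by (simp add: field_simps)
  qed
  also have "(fact n * exp t * (1 / l) + exp t / l) / 2 = (fact n + 1) / 2 * exp t * (1 / l)"
    using l by (simp add: field_simps)
  also have "1 / l = t powr (- real n / 2)"
    by (simp add: l_def powr_minus inverse_eq_divide)
  finally show ?thesis .
qed

section \<open>Decay of convolution powers\<close>

text \<open>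
  Induction on \<open>m\<close>, peeling off one factor \<open>c U + R\<close>: the part \<open>U\<close> raises the number \<open>i\<close> of box
  factors by one, and the part \<open>R\<close> only multiplies the supremum by its mass.
\<close>

lemma nn_conv_mixture_power_le:
  assumes [measurable]: "U \<in> borel_measurable borel" "R \<in> borel_measurable borel" "g \<in> borel_measurable borel"
    and f: "f = (\<lambda>x. c * U x + R x)"
    and K: "\<And>i x. (nn_conv U ^^ i) g x \<le> K i"
  shows "(nn_conv f ^^ m) ((nn_conv U ^^ i) g) x \<le>
    (\<Sum>b\<le>m. of_nat (m choose b) * (c ^ b * (\<integral>\<^sup>+ x. R x \<partial>lborel) ^ (m - b) * K (i + b)))"
proof (induction m arbitrary: i x)
  case 0
  then show ?case using K by simp
next
  case (Suc m)
  have [measurable]: "f \<in> borel_measurable borel" unfolding f by measurable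
  define \<rho> where "\<rho> = (\<integral>\<^sup>+ x. R x \<partial>lborel)"
  let ?G = "(nn_conv f ^^ m) ((nn_conv U ^^ i) g)"
  have U: "nn_conv U ?G x \<le> (\<Sum>b\<le>m. of_nat (m choose b) * (c ^ b * \<rho> ^ (m - b) * K (Suc i + b)))"
    using Suc[of "Suc i" x] nn_conv_power_commute[of f U "(nn_conv U ^^ i) g" m] by (simp add: \<rho>_def)
  have R: "nn_conv R ?G x \<le> (\<Sum>b\<le>m. of_nat (m choose b) * (c ^ b * \<rho> ^ (m - b) * K (i + b))) * \<rho>"
    unfolding \<rho>_def by (rule nn_conv_le) (use Suc in auto)
  have split: "nn_conv f G x = c * nn_conv U G x + nn_conv R G x" if [measurable]: "G \<in> borel_measurable borel" for G
    unfolding f by (simp add: nn_conv_add_left nn_conv_cmult_left)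
  have "(nn_conv f ^^ Suc m) ((nn_conv U ^^ i) g) x = c * nn_conv U ?G x + nn_conv R ?G x"
    by (simp add: split)
  also have "\<dots> \<le> c * (\<Sum>b\<le>m. of_nat (m choose b) * (c ^ b * \<rho> ^ (m - b) * K (Suc i + b))) +
     (\<Sum>b\<le>m. of_nat (m choose b) * (c ^ b * \<rho> ^ (m - b) * K (i + b))) * \<rho>"
    by (intro add_mono mult_left_mono U R) auto
  also have "\<dots> = (\<Sum>b\<le>m. of_nat (m choose b) * (c ^ b * \<rho> ^ (Suc m - b) * K (i + b) +
      c ^ Suc b * \<rho> ^ (Suc m - Suc b) * K (i + Suc b)))"
    by (auto simp: sum_distrib_left sum_distrib_right sum.distrib[symmetric] Suc_diff_le distrib_left mult_ac add_ac
        intro!: sum.cong)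
  also have "\<dots> = (\<Sum>b\<le>Suc m. of_nat (Suc m choose b) * (c ^ b * \<rho> ^ (Suc m - b) * K (i + b)))"
    by (rule sum_binomial_Suc[symmetric])
  finally show ?case by (simp only: \<rho>_def)
qed

text \<open>
  The first \<open>K + 1\<close> factors are set aside to have a bounded density, and one more factor if needed to
  make the number of the others even; the latter are grouped in pairs \<open>f * f = c U + R\<close>.
\<close>

lemma nn_conv_power_decay:
  fixes f :: "'a::euclidean_space \<Rightarrow> ennreal"
  assumes [measurable]: "f \<in> borel_measurable borel" and f1: "(\<integral>\<^sup>+ x. f x \<partial>lborel) = 1"
    and M: "0 \<le> M" "\<And>x. (nn_conv f ^^ K) f x \<le> ennreal M"
  shows "\<exists>C>0. \<forall>k\<ge>K. \<forall>x. (nn_conv f ^^ k) f x \<le> ennreal (C * (real k + 2) powr (- real DIM('a) / 2))"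
proof -
  define n where "n = DIM('a)"
  obtain x0 h c where hc: "0 < h" "0 < c"
    and le: "\<And>x. ennreal c * (\<Prod>b\<in>Basis. indicator {x0 \<bullet> b..<x0 \<bullet> b + 2 * h} (x \<bullet> b)) \<le> nn_conv f f x"
    using nn_conv_ge_box[of f] f1 by auto
  define U where "U = (\<lambda>x::'a. \<Prod>b\<in>Basis. indicator {x0 \<bullet> b..<x0 \<bullet> b + 2 * h} (x \<bullet> b) :: ennreal)"
  define R where "R x = nn_conv f f x - ennreal c * U x" for x
  have [measurable]: "U \<in> borel_measurable borel" unfolding U_def by measurable
  have [measurable]: "R \<in> borel_measurable borel" unfolding R_def by measurable
  have split: "nn_conv f f = (\<lambda>x. ennreal c * U x + R x)"
    using le by (auto simp: R_def U_def add_diff_inverse_ennreal)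
  define \<delta> where "\<delta> = c * (2 * h) ^ n"
  have \<delta>: "0 < \<delta>" using hc by (simp add: \<delta>_def)
  have "(\<integral>\<^sup>+ x. U x \<partial>lborel) = (\<Prod>b\<in>(Basis :: 'a set). \<integral>\<^sup>+ x. indicator {x0 \<bullet> b..<x0 \<bullet> b + 2 * h} x \<partial>lborel)"
    unfolding U_def by (rule nn_integral_lborel_prod) auto
  also have "\<dots> = ennreal ((2 * h) ^ n)" using hc by (simp add: n_def ennreal_power)
  finally have intU: "(\<integral>\<^sup>+ x. U x \<partial>lborel) = ennreal ((2 * h) ^ n)" .
  have "1 = (\<integral>\<^sup>+ x. nn_conv f f x \<partial>lborel)" by (simp add: nn_integral_nn_conv f1)
  also have "\<dots> = ennreal c * (\<integral>\<^sup>+ x. U x \<partial>lborel) + (\<integral>\<^sup>+ x. R x \<partial>lborel)"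
    unfolding split by (simp add: nn_integral_add nn_integral_cmult)
  also have "ennreal c * (\<integral>\<^sup>+ x. U x \<partial>lborel) = ennreal \<delta>"
    using hc by (simp add: intU \<delta>_def ennreal_mult)
  finally have mass: "ennreal \<delta> + (\<integral>\<^sup>+ x. R x \<partial>lborel) = 1" by simp
  then obtain \<rho> where \<rho>: "(\<integral>\<^sup>+ x. R x \<partial>lborel) = ennreal \<rho>" "0 \<le> \<rho>"
    by (cases "\<integral>\<^sup>+ x. R x \<partial>lborel") (auto simp: top_unique)
  have sum1: "\<delta> + \<rho> = 1" using mass \<rho> \<delta> by (simp add: ennreal_plus[symmetric] del: ennreal_plus)
  define M' where "M' = M + 2 powr (real n / 2) / h ^ n"
  have M': "0 < M'" using M hc by (auto simp: M'_def intro!: add_nonneg_pos)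
  define C where "C = M' * ((fact n / \<delta> ^ n + 1) / 2)"
  have C: "0 < C" using M' \<delta> by (auto simp: C_def intro!: mult_pos_pos add_pos_pos)
  \<comment> \<open>The \<open>m\<close>-fold convolution of \<open>c U + R\<close> has between \<open>0\<close> and \<open>m\<close> box factors; \<open>F\<close> is the bounded
    density that was set aside.\<close>
  have even: "(nn_conv (nn_conv f f) ^^ m) F x \<le> ennreal (C * (real m + 1) powr (- real n / 2))"
    if [measurable]: "F \<in> borel_measurable borel" and F1: "(\<integral>\<^sup>+ x. F x \<partial>lborel) = 1"
      and FM: "\<And>x. F x \<le> ennreal M" for F m x
  proof -
    let ?K = "\<lambda>i. ennreal (M' * ((2 * h) ^ n) ^ i * (real i + 1) powr (- real n / 2))"
    have "(nn_conv U ^^ i) F x \<le> ?K i" for i x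
      unfolding U_def n_def M'_def by (rule box_convolution_decay[OF hc(1) M(1) that])
    from nn_conv_mixture_power_le[OF _ _ _ split this, of m 0 x]
    have "(nn_conv (nn_conv f f) ^^ m) F x \<le>
        (\<Sum>b\<le>m. of_nat (m choose b) * (ennreal c ^ b * ennreal \<rho> ^ (m - b) * ?K b))"
      by (simp add: \<rho>)
    also have "\<dots> = (\<Sum>b\<le>m. ennreal (M' * (real (m choose b) * (\<delta> ^ b * \<rho> ^ (m - b)) * (real b + 1) powr (- real n / 2))))"
    proof (rule sum.cong)
      fix b
      define X where "X = M' * ((2 * h) ^ n) ^ b * (real b + 1) powr (- real n / 2)"
      have "0 \<le> X" using M' hc by (simp add: X_def)
      then have "of_nat (m choose b) * (ennreal c ^ b * ennreal \<rho> ^ (m - b) * ennreal X) =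
          ennreal (real (m choose b) * (c ^ b * \<rho> ^ (m - b) * X))"
        using hc \<rho>(2) by (simp add: ennreal_of_nat_eq_real_of_nat ennreal_power ennreal_mult)
      also have "real (m choose b) * (c ^ b * \<rho> ^ (m - b) * X)
        = M' * (real (m choose b) * (\<delta> ^ b * \<rho> ^ (m - b)) * (real b + 1) powr (- real n / 2))"
        by (simp add: \<delta>_def X_def power_mult_distrib mult_ac)
      finally show "of_nat (m choose b) * (ennreal c ^ b * ennreal \<rho> ^ (m - b) * ?K b) =
          ennreal (M' * (real (m choose b) * (\<delta> ^ b * \<rho> ^ (m - b)) * (real b + 1) powr (- real n / 2)))"
        unfolding X_def .
    qed simp
    also have "\<dots> = ennreal (M' * (\<Sum>b\<le>m. real (m choose b) * (\<delta> ^ b * \<rho> ^ (m - b)) * (real b + 1) powr (- real n / 2)))"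
      unfolding sum_distrib_left using M' \<delta> \<rho>(2) by (intro sum_ennreal) auto
    also have "\<dots> \<le> ennreal (M' * ((fact n / \<delta> ^ n + 1) / 2 * (real m + 1) powr (- real n / 2)))"
      using M' by (intro ennreal_leI mult_left_mono binomial_expectation_decay \<delta> \<rho>(2) sum1) auto
    finally show ?thesis by (simp add: C_def mult.assoc)
  qed
  have F1: "(\<integral>\<^sup>+ x. (nn_conv f ^^ k) f x \<partial>lborel) = 1" for k
    by (induction k) (simp_all add: f1 nn_integral_nn_conv)
  show ?thesis
  proof (intro exI[of _ "C * (real K + 3) powr (real n / 2)"] conjI allI impI)
    show "0 < C * (real K + 3) powr (real n / 2)" using C by simp
    fix k x assume k: "K \<le> k"
    define m s where "m = (k - K) div 2" and "s = (k - K) mod 2"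
    have k_eq: "k = 2 * m + (s + K)" using k by (auto simp: m_def s_def)
    have "s < 2" by (simp add: s_def)
    then have "k \<le> 2 * m + K + 1" using k_eq by simp
    let ?F = "(nn_conv f ^^ (s + K)) f"
    have "?F x \<le> ennreal M" for x
      unfolding funpow_add o_def by (rule nn_conv_power_le) (use M f1 in auto)
    then have "(nn_conv (nn_conv f f) ^^ m) ?F x \<le> ennreal (C * (real m + 1) powr (- real n / 2))"
      by (intro even F1) auto
    moreover have "(nn_conv f ^^ k) f = (nn_conv (nn_conv f f) ^^ m) ?F"
      by (subst k_eq, subst funpow_add) (simp add: nn_conv_power_double)
    ultimately have "(nn_conv f ^^ k) f x \<le> ennreal (C * (real m + 1) powr (- real n / 2))" by simp
    also have "\<dots> \<le> ennreal (C * ((real k + 2) / (real K + 3)) powr (- real n / 2))"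
    proof (intro ennreal_leI mult_left_mono powr_mono2')
      have "k + 2 \<le> (K + 3) * (m + 1)" using \<open>k \<le> 2 * m + K + 1\<close> by (simp add: algebra_simps)
      then have "real (k + 2) \<le> real ((K + 3) * (m + 1))" by (simp only: of_nat_le_iff)
      then show "(real k + 2) / (real K + 3) \<le> real m + 1" by (simp add: field_simps)
    qed (use C in auto)
    also have "C * ((real k + 2) / (real K + 3)) powr (- real n / 2) =
        C * (real K + 3) powr (real n / 2) * (real k + 2) powr (- real n / 2)"
      by (simp add: powr_divide powr_minus field_simps)
    finally show "(nn_conv f ^^ k) f x \<le> ennreal (C * (real K + 3) powr (real n / 2) * (real k + 2) powr (- real DIM('a) / 2))"
      by (simp add: n_def)
  qed
qed

section \<open>From kernels to the evolution equation\<close>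

lemma norm_conv_op_le_nn_conv:
  fixes J v :: "'a::euclidean_space \<Rightarrow> complex"
  assumes [measurable]: "f \<in> borel_measurable borel" "g \<in> borel_measurable borel"
    and J: "AE x in lebesgue. ennreal (norm (J x)) \<le> f x" and v: "AE x in lebesgue. ennreal (norm (v x)) \<le> g x"
  shows "ennreal (norm (conv_op J v x)) \<le> nn_conv f g x"
proof (cases "integrable lebesgue (\<lambda>y. J (x - y) * v y)")
  case True
  have "ennreal (norm (conv_op J v x)) \<le> (\<integral>\<^sup>+ y. ennreal (norm (J (x - y) * v y)) \<partial>lebesgue)"
    unfolding conv_op_def by (rule integral_norm_bound_ennreal[OF True])
  also have "\<dots> \<le> (\<integral>\<^sup>+ y. f (x - y) * g y \<partial>lebesgue)"
    by (rule nn_integral_mono_AE, use AE_reflect_lebesgue[OF J, of x] v in eventually_elim)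
      (simp add: norm_mult ennreal_mult mult_mono)
  also have "\<dots> = nn_conv f g x"
    unfolding nn_conv_def by (rule nn_integral_completion)
  finally show ?thesis .
next
  case False
  then show ?thesis by (simp add: conv_op_def not_integrable_integral_eq)
qed

lemma norm_conv_op_power_le_nn_conv_power:
  fixes J v :: "'a::euclidean_space \<Rightarrow> complex"
  assumes [measurable]: "f \<in> borel_measurable borel" "g \<in> borel_measurable borel"
    and J: "AE x in lebesgue. ennreal (norm (J x)) \<le> f x" and v: "AE x in lebesgue. ennreal (norm (v x)) \<le> g x"
  shows "AE x in lebesgue. ennreal (norm ((conv_op J ^^ k) v x)) \<le> (nn_conv f ^^ k) g x"
proof (induction k)
  case (Suc k)
  then show ?case using norm_conv_op_le_nn_conv[OF _ _ J Suc] by simp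
qed (simp add: v)

text \<open>
  The excess of the norm of \<open>v\<close> over \<open>\<kappa>\<close> is at most the distance from \<open>v\<close> to any function that is
  bounded by \<open>\<kappa>\<close>, so its integral is at most the \<open>L\<^sup>1\<close> distance.
\<close>

lemma AE_norm_le_of_L1_limit:
  fixes v :: "'a \<Rightarrow> 'b::{second_countable_topology, real_normed_vector}"
  assumes v [measurable]: "v \<in> borel_measurable M" and p [measurable]: "\<And>m. p m \<in> borel_measurable M"
    and lim: "(\<lambda>m. \<integral>\<^sup>+ x. ennreal (norm (v x - p m x)) \<partial>M) \<longlonglongrightarrow> 0"
    and bound: "\<forall>\<^sub>F m in sequentially. AE x in M. norm (p m x) \<le> \<kappa>"
  shows "AE x in M. norm (v x) \<le> \<kappa>"
proof -
  have "\<forall>\<^sub>F m in sequentially. (\<integral>\<^sup>+ x. ennreal (norm (v x) - \<kappa>) \<partial>M) \<le> (\<integral>\<^sup>+ x. ennreal (norm (v x - p m x)) \<partial>M)"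
    using bound
  proof eventually_elim
    case (elim m)
    show ?case
    proof (rule nn_integral_mono_AE, use elim in eventually_elim)
      case (elim x)
      then show ?case
        using norm_triangle_ineq2[of "v x" "p m x"] by (intro ennreal_leI) linarith
    qed
  qed
  then have "(\<integral>\<^sup>+ x. ennreal (norm (v x) - \<kappa>) \<partial>M) \<le> 0"
    by (rule tendsto_lowerbound[OF lim]) simp
  then have "AE x in M. ennreal (norm (v x) - \<kappa>) = 0"
    by (subst nn_integral_0_iff_AE[symmetric]) auto
  then show ?thesis by eventually_elim (simp add: ennreal_eq_0_iff)
qed

lemma solution_tail_bound:
  fixes J u0 :: "'a::euclidean_space \<Rightarrow> complex"
  assumes J: "integrable lebesgue J" and u0: "integrable lebesgue u0" and u: "is_solution J 1 u0 u"
    and t: "0 < t" and C: "0 \<le> C"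
    and bound: "\<And>k. N \<le> k \<Longrightarrow> AE x in lebesgue. norm ((conv_op J ^^ k) u0 x) \<le> C * (real k + 1) powr (- real n / 2)"
  shows "Linf_norm (\<lambda>x. u t x - of_real (exp (- t)) * (\<Sum>k<N. of_real (t ^ k / fact k) * (conv_op J ^^ k) u0 x))
    \<le> ennreal (C * ((fact n + 1) / 2) * t powr (- real n / 2))"
proof -
  define a where "a k x = of_real (t ^ k / fact k) * (conv_op J ^^ k) u0 x" for k x
  define v where "v x = u t x - of_real (exp (- t)) * (\<Sum>k<N. a k x)" for x
  define p where "p m x = complex_of_real (exp (- t)) * (\<Sum>k\<in>{N..<m}. a k x)" for m x
  have int: "integrable lebesgue ((conv_op J ^^ k) u0)" for k using conv_op_power_L1[OF J u0] by blast
  have [measurable]: "(conv_op J ^^ k) u0 \<in> borel_measurable lebesgue" for k using int[of k] by auto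
  have "integrable lebesgue (u t)" using u t by (simp add: is_solution_def)
  then have [measurable]: "u t \<in> borel_measurable lebesgue" by simp
  have [measurable]: "a k \<in> borel_measurable lebesgue" for k unfolding a_def by measurable
  have [measurable]: "v \<in> borel_measurable lebesgue" unfolding v_def by measurable
  have [measurable]: "p m \<in> borel_measurable lebesgue" for m unfolding p_def by measurable
  let ?\<kappa> = "C * ((fact n + 1) / 2) * t powr (- real n / 2)"
  have "AE x in lebesgue. norm (v x) \<le> ?\<kappa>"
  proof (rule AE_norm_le_of_L1_limit)
    have "(\<lambda>m. \<integral>\<^sup>+ x. ennreal (norm (u t x - exp_partial_sum J 1 u0 m t x)) \<partial>lebesgue) \<longlonglongrightarrow> 0"
      using u t by (auto simp: is_solution_def)
    moreover have "\<forall>\<^sub>F m in sequentially. (\<integral>\<^sup>+ x. ennreal (norm (u t x - exp_partial_sum J 1 u0 m t x)) \<partial>lebesgue) =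
        (\<integral>\<^sup>+ x. ennreal (norm (v x - p m x)) \<partial>lebesgue)"
      using eventually_ge_at_top[of N]
    proof eventually_elim
      case (elim m)
      have "u t x - exp_partial_sum J 1 u0 m t x = v x - p m x" for x
      proof -
        have "(\<Sum>k<m. a k x) = (\<Sum>k<N. a k x) + (\<Sum>k\<in>{N..<m}. a k x)"
          using elim by (metis atLeast0LessThan le0 sum.atLeastLessThan_concat)
        moreover have "exp_partial_sum J 1 u0 m t x = of_real (exp (- t)) * (\<Sum>k<m. a k x)"
          by (simp add: exp_partial_sum_def a_def)
        ultimately show ?thesis
          by (simp add: v_def p_def distrib_left)
      qed
      then show ?case by simp
    qed
    ultimately show "(\<lambda>m. \<integral>\<^sup>+ x. ennreal (norm (v x - p m x)) \<partial>lebesgue) \<longlonglongrightarrow> 0"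
      by (rule Lim_transform_eventually)
    have "AE x in lebesgue. \<forall>k\<in>{N..}. norm ((conv_op J ^^ k) u0 x) \<le> C * (real k + 1) powr (- real n / 2)"
      by (rule AE_ball_countable') (use bound in auto)
    then have "AE x in lebesgue. norm (p m x) \<le> ?\<kappa>" for m
    proof eventually_elim
      case (elim x)
      have "norm (\<Sum>k\<in>{N..<m}. a k x) \<le> (\<Sum>k\<in>{N..<m}. t ^ k / fact k * (C * (real k + 1) powr (- real n / 2)))"
      proof (rule sum_norm_le)
        fix k assume "k \<in> {N..<m}"
        have "norm (a k x) = t ^ k / fact k * norm ((conv_op J ^^ k) u0 x)"
          unfolding a_def norm_mult norm_of_real using t by simp
        then show "norm (a k x) \<le> t ^ k / fact k * (C * (real k + 1) powr (- real n / 2))"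
          using elim \<open>k \<in> {N..<m}\<close> t by (simp only:) (rule mult_left_mono, auto)
      qed
      also have "\<dots> \<le> (\<Sum>k<m. t ^ k / fact k * (C * (real k + 1) powr (- real n / 2)))"
        using C t by (intro sum_mono2) auto
      also have "\<dots> = C * (\<Sum>k<m. t ^ k / fact k * (real k + 1) powr (- real n / 2))"
        by (simp add: sum_distrib_left mult_ac)
      also have "\<dots> \<le> C * ((fact n + 1) / 2 * exp t * t powr (- real n / 2))"
        by (intro mult_left_mono poisson_expectation_decay t C)
      finally have "exp (- t) * norm (\<Sum>k\<in>{N..<m}. a k x) \<le> exp (- t) * (C * ((fact n + 1) / 2 * exp t * t powr (- real n / 2)))"
        by (intro mult_left_mono) auto
      also have "\<dots> = ?\<kappa>" by (simp add: exp_minus field_simps)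
      finally show ?case by (simp add: p_def norm_mult)
    qed
    then show "\<forall>\<^sub>F m in sequentially. AE x in lebesgue. norm (p m x) \<le> ?\<kappa>" by simp
  qed auto
  then have "AE x in lebesgue. ennreal (norm (v x)) \<le> ennreal ?\<kappa>"
    by eventually_elim (rule ennreal_leI)
  then show ?thesis
    unfolding Linf_norm_def v_def[symmetric, unfolded a_def] by (intro esssup_I) auto
qed

theorem corollary1:
  fixes J u0 :: "real ^ 'n \<Rightarrow> complex" and \<epsilon>0 :: ennreal
    and u :: "real \<Rightarrow> real ^ 'n \<Rightarrow> complex" and N :: nat
  assumes "integrable lebesgue J"
    and "(LINT x|lebesgue. norm (J x)) = 1"
    and "0 < \<epsilon>0"
    and "in_Lp (1 + \<epsilon>0) J"
    and "integrable lebesgue u0"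
    and "is_solution J 1 u0 u"
    and "N = nat \<lceil>enn2real (1 / \<epsilon>0)\<rceil> + 1"
  shows "\<exists>C>0. \<exists>t0>0. \<forall>t\<ge>t0.
    Linf_norm (\<lambda>x. u t x - of_real (exp (- t)) *
        (\<Sum>k<N. of_real (t ^ k / fact k) * (conv_op J ^^ k) u0 x))
      \<le> ennreal (C * t powr (- real CARD('n) / 2))"
proof -
  define n where "n = CARD('n)"
  define K where "K = nat \<lceil>enn2real (1 / \<epsilon>0)\<rceil>"
  obtain \<phi> M where [measurable]: "\<phi> \<in> borel_measurable borel"
    and \<phi>: "AE x in lebesgue. ennreal (norm (J x)) = \<phi> x"
    and M: "0 \<le> M" "\<And>x. (nn_conv \<phi> ^^ K) \<phi> x \<le> ennreal M"
    using ex_majorant_bounded_power[OF assms(1,3,4)] unfolding K_def by blast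
  obtain w where [measurable]: "w \<in> borel_measurable borel" and w: "AE x in lebesgue. u0 x = w x"
    using ex_borel_complex[of u0] assms(5) by auto
  define g where "g x = ennreal (norm (w x))" for x
  have [measurable]: "g \<in> borel_measurable borel" unfolding g_def by measurable
  have g: "AE x in lebesgue. ennreal (norm (u0 x)) = g x"
    using w by eventually_elim (simp add: g_def)
  have "(\<integral>\<^sup>+ x. \<phi> x \<partial>lborel) = (\<integral>\<^sup>+ x. \<phi> x \<partial>lebesgue)" by (simp add: nn_integral_completion)
  also have "\<dots> = (\<integral>\<^sup>+ x. ennreal (norm (J x)) \<partial>lebesgue)"
    by (rule nn_integral_cong_AE, use \<phi> in eventually_elim) simp
  also have "\<dots> = 1"
    using assms(1,2) by (subst nn_integral_eq_integral) auto
  finally have \<phi>1: "(\<integral>\<^sup>+ x. \<phi> x \<partial>lborel) = 1" .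
  have "(\<integral>\<^sup>+ x. g x \<partial>lborel) = (\<integral>\<^sup>+ x. g x \<partial>lebesgue)" by (simp add: nn_integral_completion)
  also have "\<dots> = (\<integral>\<^sup>+ x. ennreal (norm (u0 x)) \<partial>lebesgue)"
    by (rule nn_integral_cong_AE, use g in eventually_elim) simp
  also have "\<dots> = ennreal (LINT x|lebesgue. norm (u0 x))"
    using assms(5) by (intro nn_integral_eq_integral) auto
  finally obtain m where m: "(\<integral>\<^sup>+ x. g x \<partial>lborel) = ennreal m" "0 \<le> m" by auto
  obtain C where C: "0 < C"
    and decay: "\<And>k x. K \<le> k \<Longrightarrow> (nn_conv \<phi> ^^ k) \<phi> x \<le> ennreal (C * (real k + 2) powr (- real n / 2))"
    using nn_conv_power_decay[OF _ \<phi>1 M] by (auto simp: n_def)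
  have bound: "AE x in lebesgue. norm ((conv_op J ^^ k) u0 x) \<le> C * m * (real k + 1) powr (- real n / 2)"
    if Nk: "N \<le> k" for k
  proof -
    \<comment> \<open>The \<open>k\<close>-th iterate has the \<open>k\<close>-fold convolution of \<open>\<phi>\<close> as its kernel, which is
      \<open>(nn_conv \<phi> ^^ (k - 1)) \<phi>\<close>; hence \<open>N = K + 1\<close>.\<close>
    obtain j where j: "k = Suc j" "K \<le> j"
      using Nk assms(7) unfolding K_def[symmetric] by (cases k) auto
    have "AE x in lebesgue. ennreal (norm ((conv_op J ^^ k) u0 x)) \<le> (nn_conv \<phi> ^^ k) g x"
      by (rule norm_conv_op_power_le_nn_conv_power) (use \<phi> g in \<open>auto elim: eventually_mono\<close>)
    moreover have "(nn_conv \<phi> ^^ k) g x \<le> ennreal (C * m * (real k + 1) powr (- real n / 2))" for x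
    proof -
      have "(nn_conv \<phi> ^^ k) g x \<le> ennreal (C * (real j + 2) powr (- real n / 2)) * ennreal m"
        unfolding j(1) m(1)[symmetric] by (rule nn_conv_power_le_of_kernel) (use decay j in auto)
      also have "\<dots> = ennreal (C * m * (real k + 1) powr (- real n / 2))"
        using C m(2) by (simp add: j ennreal_mult[symmetric] mult_ac add_ac)
      finally show ?thesis .
    qed
    ultimately have "AE x in lebesgue. ennreal (norm ((conv_op J ^^ k) u0 x)) \<le> ennreal (C * m * (real k + 1) powr (- real n / 2))"
      by (auto elim!: eventually_mono intro: order_trans)
    then show ?thesis
      by eventually_elim (use C m(2) in simp)
  qed
  have "Linf_norm (\<lambda>x. u t x - of_real (exp (- t)) * (\<Sum>k<N. of_real (t ^ k / fact k) * (conv_op J ^^ k) u0 x))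
      \<le> ennreal ((C * (m + 1) * ((fact n + 1) / 2)) * t powr (- real n / 2))" if "t \<ge> 1" for t
  proof -
    have "Linf_norm (\<lambda>x. u t x - of_real (exp (- t)) * (\<Sum>k<N. of_real (t ^ k / fact k) * (conv_op J ^^ k) u0 x))
      \<le> ennreal (C * m * ((fact n + 1) / 2) * t powr (- real n / 2))"
      by (rule solution_tail_bound[OF assms(1,5,6) _ _ bound]) (use that C m(2) in auto)
    also have "\<dots> \<le> ennreal ((C * (m + 1) * ((fact n + 1) / 2)) * t powr (- real n / 2))"
      using C m(2) by (intro ennreal_leI mult_right_mono mult_left_mono) auto
    finally show ?thesis .
  qed
  \<comment> \<open>The factor \<open>m + 1\<close> instead of \<open>m\<close> keeps the constant positive when \<open>u0\<close> vanishes almost everywhere.\<close>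
  moreover have "0 < C * (m + 1) * ((fact n + 1) / 2)"
    using C m(2) by (auto intro!: mult_pos_pos add_pos_pos add_nonneg_pos)
  ultimately show ?thesis
    unfolding n_def by (intro exI[of _ "C * (m + 1) * ((fact (CARD('n)) + 1) / 2)"] conjI exI[of _ 1]) auto
qed

end
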